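(* Let $n>0$, $x>0$, $\delta\in\mathbb R$ and $y=x^2/(n+x^2)$. Let $c,d$ be real numbers with $0<y<c<1$ and $0<d<y<1$. Then $$F_n(x;\delta)=2P_n(x;\delta)+R_n(x;\delta),$$ where $$R_n(x;\delta)=\tfrac12\operatorname{erfc}\left(\delta/\sqrt2\right)+Q_n(x;\delta)-P_n(x;\delta)$$ $$=\tfrac12\operatorname{erfc}\left(\delta/\sqrt2\right)-\tfrac12e^{-\frac12\delta^2}\frac{\sqrt y\,(1-y)^{\frac12n}}{2\pi i}\int_{c-i\infty}^{c+i\infty}\frac{e^{\frac1{2t}\delta^2y}\operatorname{erfc}\left(\delta\sqrt{\frac{y}{2t}}\right)}{\sqrt t\,(1-t)^{\frac12n}(t-y)}\,dt$$ $$=\tfrac12e^{-\frac12\delta^2}\frac{\sqrt y\,(1-y)^{\frac12n}}{2\pi i}\int_{d-i\infty}^{d+i\infty}\frac{e^{\frac1{2t}\delta^2y}\operatorname{erfc}\left(\delta\sqrt{\frac{y}{2t}}\right)}{\sqrt t\,(1-t)^{\frac12n}(y-t)}\,dt .$$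
   Context: Notation. $\operatorname{erfc}(z)=\frac{2}{\sqrt\pi}\int_z^\infty e^{-t^2}dt$ (an entire function). $I_y(a,b)=\frac{1}{B(a,b)}\int_0^y t^{a-1}(1-t)^{b-1}dt$ is the normalized incomplete beta function, with $B(a,b)=\Gamma(a)\Gamma(b)/\Gamma(a+b)$. For $x\ge 0$, $\delta\in\mathbb R$, $n>0$ (not necessarily an integer), with $y=x^2/(n+x^2)$, the noncentral $t$-distribution is $$F_n(x;\delta)=\tfrac12\operatorname{erfc}\left(\delta/\sqrt2\right)+P_n(x;\delta)+Q_n(x;\delta),$$ $$P_n(x;\delta)=\tfrac12 e^{-\frac12\delta^2}\sum_{j=0}^\infty \frac{(\frac12\delta^2)^j}{j!}\, I_y\left(j+\tfrac12,\tfrac12 n\right),\qquad Q_n(x;\delta)=\tfrac12 e^{-\frac12\delta^2}\sum_{j=0}^\infty \frac{\delta}{\sqrt2}\frac{(\frac12\delta^2)^j}{\Gamma(j+\frac32)}\, I_y\left(j+1,\tfrac12 n\right).$$ The integrals are along the vertical lines $\Re t=c$ and $\Re t=d$; the multivalued functions $\sqrt t$ and $(1-t)^{n/2}$ are continuous on the path and take their principal values at the real point of the path. *)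

theory Defs
  imports "HOL-Analysis.Analysis"
begin

text \<open>The path from \<open>z\<close> to \<open>\<infinity>\<close> is the horizontal ray \<open>z + s\<close>, \<open>s \<ge> 0\<close>. The type is
  left general so that the same definition serves the real and the complex function.\<close>

definition erfc :: "'a::{real_normed_field, banach, second_countable_topology} \<Rightarrow> 'a" where
  "erfc z = of_real (2 / sqrt pi) *
     (LINT s:{0..}|lborel. exp (- ((z + of_real s)\<^sup>2)))"

definition inc_beta :: "real \<Rightarrow> real \<Rightarrow> real \<Rightarrow> real" where
  "inc_beta y a b = 1 / Beta a b *
     (LINT t:{0..y}|lborel. t powr (a - 1) * (1 - t) powr (b - 1))"

definition nct_P :: "real \<Rightarrow> real \<Rightarrow> real \<Rightarrow> real" where
  "nct_P n x \<delta> = (let y = x\<^sup>2 / (n + x\<^sup>2) in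
     1/2 * exp (- (\<delta>\<^sup>2 / 2)) *
       (\<Sum>j. (\<delta>\<^sup>2 / 2) ^ j / fact j * inc_beta y (real j + 1/2) (n / 2)))"

definition nct_Q :: "real \<Rightarrow> real \<Rightarrow> real \<Rightarrow> real" where
  "nct_Q n x \<delta> = (let y = x\<^sup>2 / (n + x\<^sup>2) in
     1/2 * exp (- (\<delta>\<^sup>2 / 2)) *
       (\<Sum>j. \<delta> / sqrt 2 * ((\<delta>\<^sup>2 / 2) ^ j / Gamma (real j + 3/2)) *
             inc_beta y (real j + 1) (n / 2)))"

definition nct_F :: "real \<Rightarrow> real \<Rightarrow> real \<Rightarrow> real" where
  "nct_F n x \<delta> = 1/2 * erfc (\<delta> / sqrt 2) + nct_P n x \<delta> + nct_Q n x \<delta>"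

definition nct_R :: "real \<Rightarrow> real \<Rightarrow> real \<Rightarrow> real" where
  "nct_R n x \<delta> = 1/2 * erfc (\<delta> / sqrt 2) + nct_Q n x \<delta> - nct_P n x \<delta>"

text \<open>Integration over the line \<open>Re t = c\<close>, oriented upwards; the factor \<open>\<i>\<close> is the derivative
  of the parametrization \<open>t = c + \<i> s\<close>.\<close>

definition vline_integrable :: "real \<Rightarrow> (complex \<Rightarrow> complex) \<Rightarrow> bool" where
  "vline_integrable c f \<longleftrightarrow> integrable lborel (\<lambda>s::real. f (Complex c s))"

definition vline_integral :: "real \<Rightarrow> (complex \<Rightarrow> complex) \<Rightarrow> complex" where
  "vline_integral c f = \<i> * (LINT s|lborel. f (Complex c s))"

text \<open>The numerator and the two multivalued factors common to both line integrals. For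
  \<open>0 < Re t < 1\<close> all of \<open>t\<close>, \<open>1 - t\<close> and \<open>y / (2 t)\<close> lie in the right half-plane, where the
  principal branches \<^const>\<open>csqrt\<close> and \<^const>\<open>powr\<close> are continuous; so on each of the lines used
  they are the continuous branches that are principal at the real point.\<close>

definition nct_kernel :: "real \<Rightarrow> real \<Rightarrow> real \<Rightarrow> complex \<Rightarrow> complex" where
  "nct_kernel n \<delta> y t =
     exp (1 / (2 * t) * of_real (\<delta>\<^sup>2 * y)) *
       erfc (of_real \<delta> * csqrt (of_real y / (2 * t))) /
     (csqrt t * (1 - t) powr of_real (n / 2))"

end

theory Submission
  imports Defs "HOL-Probability.Characteristic_Functions"
begin

text \<open>
  The entire function \<open>erfcx w = exp (w\<^sup>2) erfc w\<close> has the power series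
  \<open>\<Sum>k. (- w)\<^sup>k / \<Gamma> (k/2 + 1)\<close>. At \<open>w = \<delta> sqrt (y / (2 t))\<close> its even part produces the series
  of \<open>P\<close> and its odd part that of \<open>- Q\<close>, provided that for \<open>t\<close> on a line to the right of \<open>y\<close>
  \<open>I\<^sub>y(a,b) = y\<^sup>a (1 - y)\<^sup>b / (2 \<pi> i) \<integral> t\<^sup>-\<^sup>a (1 - t)\<^sup>-\<^sup>b / (t - y) dt\<close>.
  Both sides of this identity satisfy the same recurrence \<open>a \<mapsto> a + 1\<close> and tend to 0 as
  \<open>a \<rightarrow> \<infinity>\<close>. The inhomogeneous term of the recurrence is Cauchy's beta integral
  \<open>\<integral> t\<^sup>-\<^sup>a (1 - t)\<^sup>-\<^sup>b dt\<close>, a Parseval identity for two gamma densities. On a line to the left of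
  \<open>y\<close> the substitution \<open>t \<mapsto> 1 - t\<close> and \<open>I\<^bsub>1-y\<^esub>(b,a) = 1 - I\<^sub>y(a,b)\<close> give the value
  \<open>I\<^sub>y(a,b) - 1\<close> instead, so that no contour has to be shifted across the pole.
\<close>

section \<open>Series of exponential moments\<close>

lemma
  fixes f :: "nat \<Rightarrow> 'a \<Rightarrow> 'b::{banach, second_countable_topology}"
  assumes measurable: "\<And>k. f k \<in> borel_measurable M"
    and dominant: "integrable M w"
    and bound: "\<And>N x. (\<Sum>k<N. norm (f k x)) \<le> w x"
  shows integrable_suminf_dominated: "integrable M (\<lambda>x. \<Sum>k. f k x)"
    and sums_integral_dominated: "(\<lambda>k. LINT x|M. f k x) sums (LINT x|M. (\<Sum>k. f k x))"
proof -
  have term_bound: "norm (f k x) \<le> w x" for k x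
    using member_le_sum[of k "{..<Suc k}" "\<lambda>k. norm (f k x)"] bound[of x "Suc k"] by auto
  have integrable_terms: "integrable M (f k)" for k
    by (rule Bochner_Integration.integrable_bound[OF dominant measurable])
      (auto intro: order_trans[OF term_bound abs_ge_self])
  have pointwise: "AE x in M. summable (\<lambda>k. norm (f k x))"
    by (intro AE_I2 summableI_nonneg_bounded[OF _ bound]) simp
  have norms: "summable (\<lambda>k. LINT x|M. norm (f k x))"
  proof (rule summableI_nonneg_bounded)
    fix N
    have "(\<Sum>k<N. LINT x|M. norm (f k x)) = (LINT x|M. (\<Sum>k<N. norm (f k x)))"
      by (intro Bochner_Integration.integral_sum [symmetric] integrable_norm integrable_terms)
    also have "\<dots> \<le> (LINT x|M. w x)"
      by (intro integral_mono Bochner_Integration.integrable_sum integrable_norm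
          integrable_terms dominant bound)
    finally show "(\<Sum>k<N. LINT x|M. norm (f k x)) \<le> (LINT x|M. w x)" .
  qed simp
  show "integrable M (\<lambda>x. \<Sum>k. f k x)"
    "(\<lambda>k. LINT x|M. f k x) sums (LINT x|M. (\<Sum>k. f k x))"
    using integrable_suminf[OF integrable_terms pointwise norms]
      sums_integral[OF integrable_terms pointwise norms] by auto
qed

lemma power_le_fact_mult_exp:
  fixes x :: real
  assumes "x \<ge> 0"
  shows "x ^ k \<le> fact k * exp x"
proof -
  have "x ^ k /\<^sub>R fact k \<le> exp x"
    using sum_le_suminf[OF summable_exp_generic, of "{k}" x] assms by (simp add: exp_def)
  thus ?thesis by (simp add: field_simps)
qed

lemma integrable_power_mult_of_exp:
  fixes X g :: "'a \<Rightarrow> real"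
  assumes [measurable]: "X \<in> borel_measurable M" "g \<in> borel_measurable M"
    and integrable: "integrable M (\<lambda>x. exp (r * \<bar>X x\<bar>) * g x)" and r: "r > 0"
  shows "integrable M (\<lambda>x. X x ^ k * g x)"
proof (rule Bochner_Integration.integrable_bound)
  show "integrable M (\<lambda>x. fact k / r ^ k * (exp (r * \<bar>X x\<bar>) * g x))"
    using integrable by (rule integrable_mult_right)
  have "\<bar>X x\<bar> ^ k \<le> fact k / r ^ k * exp (r * \<bar>X x\<bar>)" for x
    using power_le_fact_mult_exp[of "r * \<bar>X x\<bar>" k] r by (simp add: power_mult_distrib field_simps)
  from mult_right_mono[OF this abs_ge_zero]
  show "AE x in M. norm (X x ^ k * g x) \<le> norm (fact k / r ^ k * (exp (r * \<bar>X x\<bar>) * g x))"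
    using r by (simp add: abs_mult power_abs mult.assoc)
qed measurable

lemma
  fixes z :: "'a::{real_normed_field, banach, second_countable_topology}"
    and X g :: "'b \<Rightarrow> real"
  assumes [measurable]: "X \<in> borel_measurable M" "g \<in> borel_measurable M"
    and integrable: "integrable M (\<lambda>x. exp (norm z * \<bar>X x\<bar>) * g x)"
  shows integrable_exp_transform: "integrable M (\<lambda>x. of_real (g x) * exp (of_real (X x) * z))"
    and sums_exp_transform:
      "(\<lambda>k. z ^ k / of_real (fact k) * of_real (LINT x|M. X x ^ k * g x)) sums
         (LINT x|M. of_real (g x) * exp (of_real (X x) * z))"
proof -
  define f where "f = (\<lambda>k x. of_real (g x) * ((of_real (X x) * z) ^ k /\<^sub>R fact k))"
  have measurable_f: "f k \<in> borel_measurable M" for k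
    unfolding f_def by measurable
  have bound: "(\<Sum>k<N. norm (f k x)) \<le> norm (exp (norm z * \<bar>X x\<bar>) * g x)" for N x
  proof -
    have "norm (f k x) = \<bar>g x\<bar> * ((norm z * \<bar>X x\<bar>) ^ k /\<^sub>R fact k)" for k
      by (simp add: f_def norm_mult norm_power mult_ac)
    hence "(\<lambda>k. norm (f k x)) sums (\<bar>g x\<bar> * exp (norm z * \<bar>X x\<bar>))"
      by (simp only: sums_mult exp_converges)
    thus ?thesis
      using sum_le_suminf[of "\<lambda>k. norm (f k x)" "{..<N}"]
      by (simp add: sums_iff abs_mult mult.commute)
  qed
  have suminf_f: "(\<Sum>k. f k x) = of_real (g x) * exp (of_real (X x) * z)" for x
    using sums_mult[OF exp_converges, of "of_real (g x)" "of_real (X x) * z"]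
    unfolding f_def by (rule sums_unique [symmetric])
  have integral_f: "(LINT x|M. f k x) =
      z ^ k / of_real (fact k) * of_real (LINT x|M. X x ^ k * g x)" for k
  proof -
    have f_eq: "f k x = z ^ k / of_real (fact k) * of_real (X x ^ k * g x)" for x
      by (simp add: f_def scaleR_conv_of_real power_mult_distrib field_simps)
    have "integrable M (\<lambda>x. X x ^ k * g x)" if "z ^ k \<noteq> 0"
      using integrable_power_mult_of_exp[OF _ _ integrable, of k] integrable that
      by (cases "z = 0") (auto simp: power_0_left split: if_splits)
    thus ?thesis
      unfolding f_eq integral_mult_right_zero
      by (cases "z ^ k = 0") (simp_all add: integral_of_real del: of_real_mult of_real_power)
  qed
  show "integrable M (\<lambda>x. of_real (g x) * exp (of_real (X x) * z))"
    using integrable_suminf_dominated[OF measurable_f integrable_norm[OF integrable] bound]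
    by (simp only: suminf_f)
  show "(\<lambda>k. z ^ k / of_real (fact k) * of_real (LINT x|M. X x ^ k * g x)) sums
         (LINT x|M. of_real (g x) * exp (of_real (X x) * z))"
    using sums_integral_dominated[OF measurable_f integrable_norm[OF integrable] bound]
    by (simp only: suminf_f integral_f)
qed

section \<open>The scaled complementary error function\<close>

definition erfcx :: "'a::{real_normed_field, banach, second_countable_topology} \<Rightarrow> 'a" where
  "erfcx z = exp (z\<^sup>2) * erfc z"

definition erfcx_coeff :: "nat \<Rightarrow> real" where
  "erfcx_coeff k = (- 1) ^ k / Gamma (real k / 2 + 1)"

lemma erfcx_coeff_even: "erfcx_coeff (2 * j) = 1 / fact j"
  by (simp add: erfcx_coeff_def Gamma_fact add.commute)

lemma erfcx_coeff_odd: "erfcx_coeff (2 * j + 1) = - 1 / Gamma (real j + 3 / 2)"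
proof -
  have "real (2 * j + 1) / 2 + 1 = real j + 3 / 2" by (simp add: field_simps)
  thus ?thesis by (simp add: erfcx_coeff_def del: of_nat_add of_nat_mult)
qed

lemma Gamma_nat_plus_half: "Gamma (real n + 1 / 2) = sqrt pi * fact (2 * n) / (4 ^ n * fact n)"
proof -
  have "(1 / 2 :: real) \<notin> \<int>\<^sub>\<le>\<^sub>0" by (auto elim!: nonpos_Ints_cases)
  hence "Gamma (real n + 1 / 2) = sqrt pi * pochhammer (1 / 2) n"
    by (simp add: pochhammer_Gamma Gamma_one_half_real add.commute)
  thus ?thesis by (simp add: fact_double power_mult)
qed

definition half_gaussian :: "real \<Rightarrow> real" where
  "half_gaussian u = indicator {0..} u * exp (- u\<^sup>2)"

lemma borel_measurable_half_gaussian [measurable]: "half_gaussian \<in> borel_measurable borel"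
  unfolding half_gaussian_def by measurable

lemma erfcx_coeff_eq_half_gaussian_moment:
  "erfcx_coeff k = 2 / sqrt pi * ((- 2) ^ k / fact k) * (LINT u|lborel. u ^ k * half_gaussian u)"
proof (cases "even k")
  case True
  then obtain j where k: "k = 2 * j" by (elim evenE)
  have "(LINT u|lborel. u ^ k * half_gaussian u) =
      sqrt pi / 2 * (fact (2 * j) / (2 ^ (2 * j) * fact j))"
    using gaussian_moment_even_pos[of j]
    by (simp add: k half_gaussian_def has_bochner_integral_iff mult_ac)
  thus ?thesis by (simp add: k erfcx_coeff_even power_mult)
next
  case False
  then obtain j where k: "k = 2 * j + 1" by (elim oddE)
  have moment: "(LINT u|lborel. u ^ (2 * j + 1) * half_gaussian u) = fact j / 2"
    using gaussian_moment_odd_pos[of j]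
    by (simp add: half_gaussian_def has_bochner_integral_iff mult_ac)
  have "Gamma (real j + 3 / 2) = Gamma (real (Suc j) + 1 / 2)"
    by (rule arg_cong[where f = Gamma]) simp
  also have "\<dots> = sqrt pi * (2 * (real j + 1) * fact (2 * j + 1)) /
      (4 * 4 ^ j * ((real j + 1) * fact j))"
    unfolding Gamma_nat_plus_half by (simp add: algebra_simps)
  also have "\<dots> = sqrt pi * fact (2 * j + 1) / (2 * 4 ^ j * fact j)"
    by (simp add: divide_simps del: fact_Suc)
  finally have Gamma_eq: "Gamma (real j + 3 / 2) =
      sqrt pi * fact (2 * j + 1) / (2 * 4 ^ j * fact j)" .
  show ?thesis
    unfolding k erfcx_coeff_odd moment Gamma_eq
    by (simp add: divide_simps power_mult del: fact_Suc)
qed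

lemma integrable_exp_mult_half_gaussian:
  "integrable lborel (\<lambda>u. exp (r * \<bar>u\<bar>) * half_gaussian u)"
proof -
  have "normal_density (r / 2) (1 / sqrt 2) u * sqrt pi = exp (- (u - r / 2)\<^sup>2)" for u
    by (simp add: normal_density_def power_divide)
  moreover have "integrable lborel (\<lambda>u. normal_density (r / 2) (1 / sqrt 2) u * sqrt pi)"
    by (intro integrable_mult_left integrable_normal_density) simp
  ultimately have "integrable lborel (\<lambda>u. exp (r\<^sup>2 / 4) * exp (- (u - r / 2)\<^sup>2))"
    by (intro integrable_mult_right) simp
  thus ?thesis
    unfolding half_gaussian_def
    by (rule Bochner_Integration.integrable_bound)
      (auto simp: indicator_def exp_add [symmetric] power2_eq_square algebra_simps)
qed

lemma erfcx_sums:
  fixes z :: "'a::{real_normed_field, banach, second_countable_topology}"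
  shows "(\<lambda>k. of_real (erfcx_coeff k) * z ^ k) sums erfcx z"
proof -
  let ?c = "of_real (2 / sqrt pi) :: 'a"
  let ?m = "\<lambda>k. LINT u|lborel. u ^ k * half_gaussian u"
  have "(\<lambda>k. ?c * ((-2 * z) ^ k / of_real (fact k) * of_real (?m k))) sums
      (?c * (LINT u|lborel. of_real (half_gaussian u) * exp (of_real u * (-2 * z))))"
    by (intro sums_mult sums_exp_transform integrable_exp_mult_half_gaussian) measurable
  also have "(\<lambda>k. ?c * ((-2 * z) ^ k / of_real (fact k) * of_real (?m k))) =
      (\<lambda>k. of_real (erfcx_coeff k) * z ^ k)"
    unfolding erfcx_coeff_eq_half_gaussian_moment
    by (rule ext, subst power_mult_distrib) simp
  also have "?c * (LINT u|lborel. of_real (half_gaussian u) * exp (of_real u * (-2 * z))) =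
      erfcx z"
  proof -
    have "of_real (half_gaussian u) * exp (of_real u * (-2 * z)) =
        exp (z\<^sup>2) * (indicator {0..} u *\<^sub>R exp (- ((z + of_real u)\<^sup>2)))" for u
      by (auto simp: half_gaussian_def indicator_def mult_exp_exp power2_eq_square algebra_simps
          simp flip: exp_of_real)
    thus ?thesis unfolding erfcx_def erfc_def set_lebesgue_integral_def
      by (simp only: integral_mult_right_zero) simp
  qed
  finally show ?thesis .
qed

lemma summable_norm_erfcx_coeff: "summable (\<lambda>k. norm (erfcx_coeff k * w ^ k))"
proof (rule powser_insidea)
  show "summable (\<lambda>k. erfcx_coeff k * (\<bar>w\<bar> + 1) ^ k)"
    using erfcx_sums[of "\<bar>w\<bar> + 1"] by (simp add: sums_iff)
qed simp

section \<open>The Laplace transform of the gamma density\<close>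

definition gamma_weight :: "real \<Rightarrow> real \<Rightarrow> real \<Rightarrow> real" where
  "gamma_weight a r u = indicator {0..} u * u powr (a - 1) * exp (- r * u)"

lemma borel_measurable_gamma_weight [measurable]: "gamma_weight a r \<in> borel_measurable borel"
  unfolding gamma_weight_def by measurable

lemma gamma_weight_mult:
  "gamma_weight a r u * gamma_weight b s u = gamma_weight (a + b - 1) (r + s) u"
proof -
  have "u powr (a - 1) * u powr (b - 1) = u powr (a + b - 1 - 1)"
    by (simp add: powr_add [symmetric] algebra_simps)
  moreover have "exp (- r * u) * exp (- s * u) = exp (- (r + s) * u)"
    by (simp add: mult_exp_exp algebra_simps)
  ultimately show ?thesis
    unfolding gamma_weight_def indicator_def by (simp add: mult.assoc mult.left_commute)
qed

lemma power_mult_gamma_weight: "u ^ k * gamma_weight a r u = gamma_weight (a + real k) r u"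
  by (cases "u > 0") (auto simp: gamma_weight_def indicator_def powr_diff powr_add powr_realpow)

lemma exp_mult_gamma_weight: "exp (x * \<bar>u\<bar>) * gamma_weight a r u = gamma_weight a (r - x) u"
  by (auto simp: gamma_weight_def indicator_def mult_exp_exp algebra_simps)

lemma has_bochner_integral_gamma_weight:
  assumes a: "a > 0" and r: "r > 0"
  shows "has_bochner_integral lborel (gamma_weight a r) (Gamma a / r powr a)"
proof -
  have "has_bochner_integral lborel (gamma_weight a 1) (Gamma a)"
    using Gamma_conv_nn_integral_real[OF a] a
    unfolding gamma_weight_def
    by (intro has_bochner_integral_nn_integral) (auto simp: exp_minus field_simps)
  from lborel_has_bochner_integral_real_affine_iff[of r _ _ 0, THEN iffD1, OF _ this] r
  have "has_bochner_integral lborel (\<lambda>u. r powr (1 - a) * gamma_weight a 1 (r * u))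
      (r powr (1 - a) * (Gamma a / r))"
    by (intro has_bochner_integral_mult_right) (simp add: divide_inverse mult.commute)
  also have "(\<lambda>u. r powr (1 - a) * gamma_weight a 1 (r * u)) = gamma_weight a r"
    using r by (auto simp: fun_eq_iff gamma_weight_def indicator_def zero_le_mult_iff powr_mult
        powr_diff powr_minus field_simps)
  also have "r powr (1 - a) * (Gamma a / r) = Gamma a / r powr a"
    using r by (simp add: powr_diff)
  finally show ?thesis .
qed

lemma Gamma_binomial_sums:
  fixes z :: complex
  assumes a: "a > 0" and z: "norm z < r"
  shows "(\<lambda>k. z ^ k / of_real (fact k) * of_real (Gamma (a + real k) / r powr (a + real k))) sums
           (of_real (Gamma a) * (of_real r - z) powr (- of_real a))"
proof -
  have r: "r > 0" using z norm_ge_zero[of z] by linarith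
  let ?c = "complex_of_real (Gamma a / r powr a)"
  have "norm (- z / of_real r) < 1" using z r by (simp add: norm_divide)
  hence "(\<lambda>k. ?c * ((- of_real a gchoose k) * (- z / of_real r) ^ k)) sums
      (?c * (1 + - z / of_real r) powr (- of_real a))"
    by (intro sums_mult gen_binomial_complex)
  moreover have "?c * (1 + - z / of_real r) powr (- of_real a)
      = of_real (Gamma a) * (of_real r - z) powr (- of_real a)"
  proof -
    have "(1 + - z / of_real r) powr - of_real a =
        (of_real (1 / r) * (of_real r - z)) powr - of_real a"
      using r by (simp add: field_simps)
    also have "\<dots> = of_real (1 / r) powr - of_real a * (of_real r - z) powr - of_real a"
      using r by (intro powr_times_real_left) auto
    also have "of_real (1 / r) powr - of_real a = complex_of_real (r powr a)"
      using r powr_of_real[of "1 / r" "- a"] by (simp add: powr_divide powr_minus field_simps)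
    finally show ?thesis using r by simp
  qed
  moreover have "?c * ((- of_real a gchoose k) * (- z / of_real r) ^ k)
      = z ^ k / of_real (fact k) * of_real (Gamma (a + real k) / r powr (a + real k))" for k
  proof -
    have "pochhammer a k = Gamma (a + real k) / Gamma a"
      using a by (intro pochhammer_Gamma) (auto elim!: nonpos_Ints_cases)
    hence binomial: "(- complex_of_real a gchoose k) =
        (- 1) ^ k * of_real (Gamma (a + real k) / Gamma a / fact k)"
      by (simp add: gbinomial_pochhammer pochhammer_of_real)
    have power: "(- z / of_real r) ^ k = (- 1) ^ k * (z ^ k / of_real r ^ k)"
      using power_mult_distrib[of "- 1" "z / of_real r" k] by (simp add: power_divide)
    show ?thesis
      unfolding binomial power using r Gamma_real_pos[OF a]
      by (cases "even k") (simp_all add: powr_add powr_realpow divide_simps)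
  qed
  ultimately show ?thesis by simp
qed

lemma has_bochner_integral_gamma_weight_exp_disc:
  fixes z :: complex
  assumes a: "a > 0" and z: "norm z < r"
  shows "has_bochner_integral lborel (\<lambda>u. of_real (gamma_weight a r u) * exp (of_real u * z))
           (of_real (Gamma a) * (of_real r - z) powr (- of_real a))"
proof -
  have r: "r > 0" using z norm_ge_zero[of z] by linarith
  have integrable: "integrable lborel (\<lambda>u. exp (norm z * \<bar>u\<bar>) * gamma_weight a r u)"
    using has_bochner_integral_gamma_weight[of a "r - norm z"] a z
    by (simp add: exp_mult_gamma_weight has_bochner_integral_iff)
  have moment: "(LINT u|lborel. u ^ k * gamma_weight a r u) =
      Gamma (a + real k) / r powr (a + real k)" for k
    using has_bochner_integral_gamma_weight[of "a + real k" r] a r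
    by (simp add: power_mult_gamma_weight has_bochner_integral_iff)
  have "(LINT u|lborel. of_real (gamma_weight a r u) * exp (of_real u * z)) =
      of_real (Gamma a) * (of_real r - z) powr (- of_real a)"
    using sums_exp_transform[OF _ _ integrable] Gamma_binomial_sums[OF a z]
    unfolding moment by (intro sums_unique2) auto
  thus ?thesis
    using integrable_exp_transform[OF _ _ integrable] by (simp add: has_bochner_integral_iff)
qed

lemma has_bochner_integral_gamma_weight_exp:
  fixes z :: complex
  assumes a: "a > 0" and z: "Re z < r"
  shows "has_bochner_integral lborel (\<lambda>u. of_real (gamma_weight a r u) * exp (of_real u * z))
           (of_real (Gamma a) * (of_real r - z) powr (- of_real a))"
proof -
  \<comment> \<open>The integrand depends on \<open>r - z\<close> only, and every point of the right half-plane lies in a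
    disc around some \<open>\<rho> > 0\<close> of radius less than \<open>\<rho>\<close>.\<close>
  define t where "t = of_real r - z"
  define \<rho> where "\<rho> = (norm t)\<^sup>2 / Re t"
  have t: "Re t > 0" "norm t > 0" using z by (auto simp: t_def)
  have "(norm (of_real \<rho> - t))\<^sup>2 = \<rho>\<^sup>2 - 2 * (\<rho> * Re t) + (norm t)\<^sup>2"
    by (simp add: cmod_power2 power2_diff algebra_simps)
  also have "\<rho> * Re t = (norm t)\<^sup>2" using t by (simp add: \<rho>_def)
  finally have "(norm (of_real \<rho> - t))\<^sup>2 < \<rho>\<^sup>2" using t by simp
  moreover have "\<rho> \<ge> 0" using t by (simp add: \<rho>_def)
  ultimately have "norm (of_real \<rho> - t) < \<rho>" by (rule power2_less_imp_less)
  from has_bochner_integral_gamma_weight_exp_disc[OF a this]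
  have "has_bochner_integral lborel
      (\<lambda>u. of_real (gamma_weight a \<rho> u) * exp (of_real u * (of_real \<rho> - t)))
      (of_real (Gamma a) * t powr (- of_real a))"
    by simp
  moreover have "of_real (gamma_weight a \<rho> u) * exp (of_real u * (of_real \<rho> - t)) =
      of_real (gamma_weight a r u) * exp (of_real u * z)" for u
    by (simp add: gamma_weight_def t_def mult_exp_exp algebra_simps flip: exp_of_real)
  ultimately show ?thesis by (simp only: t_def)
qed

section \<open>Fourier inversion\<close>

definition fourier_transform :: "(real \<Rightarrow> complex) \<Rightarrow> real \<Rightarrow> complex" where
  "fourier_transform f s = (LINT u|lborel. f u * iexp (- s * u))"

lemma integrable_mult_iexp:
  assumes "integrable lborel f"
  shows "integrable lborel (\<lambda>u. f u * iexp (s * u))"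
proof (rule Bochner_Integration.integrable_bound[OF assms])
  have [measurable]: "f \<in> borel_measurable borel" using assms by auto
  show "(\<lambda>u. f u * iexp (s * u)) \<in> borel_measurable lborel" by measurable
qed (simp add: norm_mult)

lemma fourier_transform_exchange:
  assumes f: "integrable lborel f" and g: "integrable lborel g"
  shows "(LINT s|lborel. f s * fourier_transform g s) =
      (LINT u|lborel. fourier_transform f u * g u)"
proof -
  have [measurable]: "f \<in> borel_measurable borel" "g \<in> borel_measurable borel"
    using f g by auto
  let ?F = "\<lambda>s u. f s * (g u * iexp (- s * u))"
  have "integrable (lborel \<Otimes>\<^sub>M lborel) (\<lambda>(s, u). ?F s u)"
  proof (rule lborel_pair.Fubini_integrable)
    have "integrable lborel (\<lambda>s. norm (f s) * (LINT u|lborel. norm (g u)))"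
      using f by simp
    thus "integrable lborel (\<lambda>s. LINT u|lborel. norm ((\<lambda>(s, u). ?F s u) (s, u)))"
      by (simp add: norm_mult)
    show "AE s in lborel. integrable lborel (\<lambda>u. (\<lambda>(s, u). ?F s u) (s, u))"
      unfolding prod.case by (intro AE_I2 integrable_mult_right integrable_mult_iexp g)
  qed measurable
  from lborel_pair.Fubini_integral[OF this]
  have "(LINT u|lborel. LINT s|lborel. ?F s u) = (LINT s|lborel. LINT u|lborel. ?F s u)" .
  moreover have "(LINT s|lborel. ?F s u) = fourier_transform f u * g u" for u
  proof -
    have "(LINT s|lborel. ?F s u) = (LINT s|lborel. f s * iexp (- u * s) * g u)"
      by (simp add: mult_ac)
    thus ?thesis unfolding fourier_transform_def integral_mult_left_zero .
  qed
  ultimately show ?thesis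
    by (simp only: fourier_transform_def integral_mult_right_zero)
qed

lemma fourier_transform_std_normal_density:
  "fourier_transform (\<lambda>x. of_real (std_normal_density x)) s =
      of_real (sqrt (2 * pi) * std_normal_density s)"
proof -
  have "fourier_transform (\<lambda>x. of_real (std_normal_density x)) s =
      char std_normal_distribution (- s)"
    unfolding char_def fourier_transform_def
    by (subst integral_density) (auto simp: scaleR_conv_of_real)
  thus ?thesis
    unfolding char_std_normal_distribution by (simp add: std_normal_density_def)
qed

lemma fourier_transform_scaled_std_normal_density:
  assumes \<sigma>: "\<sigma> > 0"
  shows "fourier_transform (\<lambda>s. of_real (std_normal_density (\<sigma> * s)) * iexp (s * v)) u =
           of_real (sqrt (2 * pi) / \<sigma> * std_normal_density ((u - v) / \<sigma>))"
proof -
  have phase: "iexp (- ((u - v) / \<sigma>) * (\<sigma> * s)) = iexp (s * v) * iexp (- u * s)" for s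
  proof -
    have "- ((u - v) / \<sigma>) * (\<sigma> * s) = s * v + - u * s" using \<sigma> by (simp add: field_simps)
    thus ?thesis by (simp only: of_real_add distrib_left exp_add)
  qed
  have "fourier_transform (\<lambda>x. of_real (std_normal_density x)) ((u - v) / \<sigma>) =
      \<sigma> * (LINT s|lborel. of_real (std_normal_density (\<sigma> * s)) *
        iexp (- ((u - v) / \<sigma>) * (\<sigma> * s)))"
    unfolding fourier_transform_def using \<sigma>
    by (subst lborel_integral_real_affine[of \<sigma> _ 0]) (auto simp: scaleR_conv_of_real)
  also have "(LINT s|lborel. of_real (std_normal_density (\<sigma> * s)) *
      iexp (- ((u - v) / \<sigma>) * (\<sigma> * s))) =
      fourier_transform (\<lambda>s. of_real (std_normal_density (\<sigma> * s)) * iexp (s * v)) u"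
    by (simp only: fourier_transform_def phase mult.assoc)
  finally show ?thesis
    using \<sigma> unfolding fourier_transform_std_normal_density by (simp add: field_simps)
qed

lemma gaussian_regularized_fourier_inversion:
  assumes h: "integrable lborel h" and \<sigma>: "\<sigma> > 0"
  shows "(LINT s|lborel. of_real (std_normal_density (\<sigma> * s)) * (fourier_transform h s * iexp (s * v)))
      = of_real (sqrt (2 * pi)) * (LINT z|lborel. of_real (std_normal_density z) * h (v + \<sigma> * z))"
proof -
  let ?g = "\<lambda>s. complex_of_real (std_normal_density (\<sigma> * s)) * iexp (s * v)"
  have "integrable lborel (\<lambda>s. std_normal_density (\<sigma> * s))"
    using lborel_integrable_real_affine[OF integrable_normal_density[of 1 0], of \<sigma> 0] \<sigma> by simp
  hence "integrable lborel (\<lambda>s. complex_of_real (std_normal_density (\<sigma> * s)) * iexp (v * s))"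
    by (intro integrable_mult_iexp) simp
  hence "integrable lborel ?g" by (simp only: mult.commute[of v])
  from fourier_transform_exchange[OF this h]
  have "(LINT s|lborel. ?g s * fourier_transform h s) =
      (LINT u|lborel. of_real (sqrt (2 * pi) / \<sigma> * std_normal_density ((u - v) / \<sigma>)) * h u)"
    using \<sigma> by (simp only: fourier_transform_scaled_std_normal_density)
  also have "\<dots> = (LINT z|lborel. of_real (sqrt (2 * pi)) *
      (of_real (std_normal_density z) * h (v + \<sigma> * z)))"
    using \<sigma> by (subst lborel_integral_real_affine[of \<sigma> _ v])
      (auto simp: scaleR_conv_of_real field_simps)
  finally show ?thesis by (simp only: integral_mult_right_zero) (simp only: mult_ac)
qed

lemma gaussian_mean_tendsto:
  fixes h :: "real \<Rightarrow> complex"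
  assumes [measurable]: "h \<in> borel_measurable borel"
    and bounded: "\<And>u. norm (h u) \<le> B" and cont: "isCont h v" and \<sigma>: "\<sigma> \<longlonglongrightarrow> 0"
  shows "(\<lambda>k. LINT z|lborel. of_real (std_normal_density z) * h (v + \<sigma> k * z)) \<longlonglongrightarrow> h v"
proof -
  have "(\<lambda>k. LINT z|lborel. of_real (std_normal_density z) * h (v + \<sigma> k * z))
      \<longlonglongrightarrow> (LINT z|lborel. of_real (std_normal_density z) * h v)"
  proof (rule integral_dominated_convergence[where w = "\<lambda>z. std_normal_density z * B"])
    have "(\<lambda>k. h (v + \<sigma> k * z)) \<longlonglongrightarrow> h v" for z
    proof (rule isCont_tendsto_compose[OF cont])
      show "(\<lambda>k. v + \<sigma> k * z) \<longlonglongrightarrow> v"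
        using tendsto_add[OF tendsto_const tendsto_mult_left_zero[OF \<sigma>], of v z] by simp
    qed
    thus "AE z in lborel. (\<lambda>k. of_real (std_normal_density z) * h (v + \<sigma> k * z))
        \<longlonglongrightarrow> of_real (std_normal_density z) * h v"
      by (intro AE_I2 tendsto_intros)
    show "AE z in lborel. norm (of_real (std_normal_density z) * h (v + \<sigma> k * z)) \<le>
        std_normal_density z * B" for k
      using bounded by (auto simp: norm_mult intro!: mult_left_mono)
  qed (auto intro!: integrable_mult_left integrable_normal_density)
  thus ?thesis by simp
qed

lemma integral_std_normal_density_mult_tendsto:
  fixes f :: "real \<Rightarrow> complex"
  assumes f: "integrable lborel f" and \<sigma>: "\<sigma> \<longlonglongrightarrow> 0"
  shows "(\<lambda>k. LINT s|lborel. of_real (std_normal_density (\<sigma> k * s)) * f s)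
           \<longlonglongrightarrow> of_real (std_normal_density 0) * (LINT s|lborel. f s)"
proof -
  have [measurable]: "f \<in> borel_measurable borel" using f by auto
  have "(\<lambda>k. LINT s|lborel. of_real (std_normal_density (\<sigma> k * s)) * f s)
      \<longlonglongrightarrow> (LINT s|lborel. of_real (std_normal_density 0) * f s)"
  proof (rule integral_dominated_convergence[where w = "\<lambda>s. std_normal_density 0 * norm (f s)"])
    have "isCont std_normal_density 0"
      unfolding std_normal_density_def by (intro continuous_intros) auto
    hence "(\<lambda>k. std_normal_density (\<sigma> k * s)) \<longlonglongrightarrow> std_normal_density 0" for s
      by (rule isCont_tendsto_compose) (rule tendsto_mult_left_zero[OF \<sigma>])
    thus "AE s in lborel. (\<lambda>k. of_real (std_normal_density (\<sigma> k * s)) * f s)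
        \<longlonglongrightarrow> of_real (std_normal_density 0) * f s"
      by (intro AE_I2 tendsto_intros)
    have "std_normal_density x \<le> std_normal_density 0" for x
      by (auto simp: std_normal_density_def intro!: divide_right_mono)
    thus "AE s in lborel. norm (of_real (std_normal_density (\<sigma> k * s)) * f s) \<le>
        std_normal_density 0 * norm (f s)" for k
      by (auto simp: norm_mult intro!: mult_right_mono)
  qed (use f in \<open>auto intro!: integrable_mult_right integrable_norm\<close>)
  thus ?thesis by simp
qed

lemma fourier_inversion:
  fixes h :: "real \<Rightarrow> complex"
  assumes h: "integrable lborel h" and bounded: "\<And>u. norm (h u) \<le> B" and cont: "isCont h v"
    and transform: "integrable lborel (fourier_transform h)"
  shows "fourier_transform (fourier_transform h) (- v) = 2 * pi * h v"
proof -
  have measurable_h: "h \<in> borel_measurable borel" using h by auto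
  define \<sigma> where "\<sigma> = (\<lambda>k. inverse (real (Suc k)))"
  have \<sigma>: "\<sigma> \<longlonglongrightarrow> 0" "\<sigma> k > 0" for k
    unfolding \<sigma>_def by (rule LIMSEQ_inverse_real_of_nat) simp
  let ?f = "\<lambda>s. fourier_transform h s * iexp (s * v)"
  have "integrable lborel ?f"
    using integrable_mult_iexp[OF transform, of v] by (simp only: mult.commute[of v])
  hence "(\<lambda>k. LINT s|lborel. of_real (std_normal_density (\<sigma> k * s)) * ?f s)
      \<longlonglongrightarrow> of_real (std_normal_density 0) * (LINT s|lborel. ?f s)"
    using \<sigma>(1) by (rule integral_std_normal_density_mult_tendsto)
  moreover have "(\<lambda>k. LINT s|lborel. of_real (std_normal_density (\<sigma> k * s)) * ?f s)
      \<longlonglongrightarrow> of_real (sqrt (2 * pi)) * h v"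
    unfolding gaussian_regularized_fourier_inversion[OF h \<sigma>(2)]
    by (intro tendsto_mult_left gaussian_mean_tendsto[OF measurable_h bounded cont \<sigma>(1)])
  ultimately have "of_real (std_normal_density 0) * (LINT s|lborel. ?f s) =
      of_real (sqrt (2 * pi)) * h v"
    by (rule LIMSEQ_unique)
  hence "of_real (sqrt (2 * pi) * std_normal_density 0) * (LINT s|lborel. ?f s) =
      of_real (sqrt (2 * pi) * sqrt (2 * pi)) * h v"
    by (simp only: of_real_mult mult.assoc)
  thus ?thesis
    by (simp add: fourier_transform_def std_normal_density_def mult.commute[of v])
qed

lemma fourier_parseval:
  fixes h g :: "real \<Rightarrow> complex"
  assumes h: "integrable lborel h" and bounded: "\<And>u. norm (h u) \<le> B" and cont: "\<And>u. isCont h u"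
    and transform: "integrable lborel (fourier_transform h)" and g: "integrable lborel g"
  shows "(LINT s|lborel. fourier_transform h s * fourier_transform g (- s)) =
           2 * pi * (LINT u|lborel. h u * g u)"
proof -
  have reflect: "fourier_transform (\<lambda>u. g (- u)) s = fourier_transform g (- s)" for s
    unfolding fourier_transform_def
    by (subst lborel_integral_real_affine[of "- 1" _ 0]) auto
  have "integrable lborel (\<lambda>u. g (- u))"
    using lborel_integrable_real_affine[OF g, of "- 1" 0] by simp
  from fourier_transform_exchange[OF transform this]
  have "(LINT s|lborel. fourier_transform h s * fourier_transform g (- s)) =
      (LINT u|lborel. fourier_transform (fourier_transform h) u * g (- u))"
    by (simp only: reflect)
  also have "\<dots> = (LINT u|lborel. fourier_transform (fourier_transform h) (- u) * g u)"
    by (subst lborel_integral_real_affine[of "- 1" _ 0]) auto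
  also have "\<dots> = (LINT u|lborel. 2 * pi * (h u * g u))"
    by (simp only: fourier_inversion[OF h bounded cont transform] mult.assoc)
  finally show ?thesis by simp
qed

section \<open>Cauchy's beta integral\<close>

lemma fourier_transform_gamma_weight:
  assumes "a > 0" and "r > 0"
  shows "fourier_transform (\<lambda>u. of_real (gamma_weight a r u)) s =
           of_real (Gamma a) * Complex r s powr (- of_real a)"
proof -
  have "of_real r - (- \<i> * of_real s) = Complex r s" by (simp add: complex_eq_iff)
  thus ?thesis
    using has_bochner_integral_gamma_weight_exp[of a "- \<i> * of_real s" r] assms
    by (simp add: fourier_transform_def has_bochner_integral_iff mult_ac)
qed

lemma powr_mult_exp_neg_le:
  fixes p r u :: real
  assumes p: "p > 0" and r: "r > 0" and u: "u \<ge> 0"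
  shows "u powr p * exp (- r * u) \<le> (p / r) powr p"
proof -
  have "exp (- r * u) = exp (- r * u / p) powr p" using p by (simp add: powr_def)
  hence "u powr p * exp (- r * u) = (u * exp (- r * u / p)) powr p"
    using u by (simp add: powr_mult)
  also have "\<dots> \<le> (p / r) powr p"
  proof (rule powr_mono2)
    have "r * u / p \<le> exp (r * u / p)" using exp_ge_add_one_self[of "r * u / p"] by linarith
    thus "u * exp (- r * u / p) \<le> p / r" using p r by (simp add: exp_minus field_simps)
  qed (use p u in auto)
  finally show ?thesis .
qed

lemma gamma_weight_bounded:
  assumes "a > 1" and "r > 0"
  shows "\<bar>gamma_weight a r u\<bar> \<le> ((a - 1) / r) powr (a - 1)"
  using powr_mult_exp_neg_le[of "a - 1" r u] assms
  by (auto simp: gamma_weight_def indicator_def abs_mult)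

lemma isCont_gamma_weight:
  assumes "a > 1"
  shows "isCont (gamma_weight a r) u"
proof -
  have "gamma_weight a r = (\<lambda>u. max 0 u powr (a - 1) * exp (- r * u))"
    by (auto simp: gamma_weight_def indicator_def fun_eq_iff max_def)
  moreover have "continuous_on UNIV (\<lambda>u. max 0 u powr (a - 1) * exp (- r * u))"
    using assms by (intro continuous_intros continuous_on_powr') auto
  ultimately show ?thesis by (simp add: continuous_on_eq_continuous_at)
qed

lemma integrable_powr_atLeast:
  assumes "p > 1" and "c > (0::real)"
  shows "integrable lborel (\<lambda>s. indicator {c..} s * s powr (- p))"
proof (rule integrableI_nonneg)
  show "(\<integral>\<^sup>+ s. ennreal (indicator {c..} s * s powr (- p)) \<partial>lborel) < \<infinity>"
    using nn_integral_has_integral_lebesgue[OF _ has_integral_powr_to_inf[of "- p" c]] assms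
    by simp
qed auto

lemma integrable_norm_Complex_powr:
  assumes p: "p > 1" and c: "c > 0"
  shows "integrable lborel (\<lambda>s. norm (Complex c s) powr (- p))"
proof (rule Bochner_Integration.integrable_bound)
  define J where "J = (\<lambda>s. indicator {c..} s * s powr (- p))"
  have "integrable lborel (\<lambda>s. J (c + 1 * s))" "integrable lborel (\<lambda>s. J (c + (- 1) * s))"
    using integrable_powr_atLeast[OF p c] unfolding J_def
    by (intro lborel_integrable_real_affine; simp)+
  thus "integrable lborel (\<lambda>s. 2 powr p * (J (c + s) + J (c - s)))" by simp
  have bound: "norm (Complex c s) powr (- p) \<le> 2 powr p * (J (c + s) + J (c - s))" for s
  proof -
    have "(c + \<bar>s\<bar>) / 2 \<le> norm (Complex c s)"
      using abs_Re_le_cmod[of "Complex c s"] abs_Im_le_cmod[of "Complex c s"] by simp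
    hence "norm (Complex c s) powr (- p) \<le> ((c + \<bar>s\<bar>) / 2) powr (- p)"
      using p c by (intro powr_mono2') auto
    also have "\<dots> = 2 powr p * (c + \<bar>s\<bar>) powr (- p)"
      using c by (simp add: powr_divide powr_minus divide_simps)
    also have "(c + \<bar>s\<bar>) powr (- p) \<le> J (c + s) + J (c - s)"
      using c by (cases "s \<ge> 0") (auto simp: J_def indicator_def)
    finally show ?thesis by simp
  qed
  show "AE s in lborel. norm (norm (Complex c s) powr (- p)) \<le>
      norm (2 powr p * (J (c + s) + J (c - s)))"
    using order_trans[OF bound abs_ge_self] by (intro AE_I2) simp
  have "continuous_on UNIV (\<lambda>s. norm (Complex c s) powr (- p))"
    using c by (intro continuous_intros) (auto simp: complex_eq_iff)
  thus "(\<lambda>s. norm (Complex c s) powr (- p)) \<in> borel_measurable lborel"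
    by (simp add: borel_measurable_continuous_onI)
qed

lemma integrable_Complex_powr:
  assumes a: "a > 1" and c: "c > 0"
  shows "integrable lborel (\<lambda>s. Complex c s powr (- of_real a))"
proof (rule integrable_norm_cancel)
  show "integrable lborel (\<lambda>s. norm (Complex c s powr (- of_real a)))"
    using integrable_norm_Complex_powr[OF a c] by (simp add: norm_powr_real_powr')
  have "continuous_on UNIV (\<lambda>s. Complex c s powr (- of_real a))"
    using c by (intro continuous_intros) (auto simp: complex_nonpos_Reals_iff complex_eq_iff)
  thus "(\<lambda>s. Complex c s powr (- of_real a)) \<in> borel_measurable lborel"
    by (simp add: borel_measurable_continuous_onI)
qed

lemma cauchy_beta_integral:
  assumes a: "a > 1" and b: "b > 0" and c: "c > 0" and r: "r > 0"
  shows "(LINT s|lborel. Complex c s powr (- of_real a) * Complex r (- s) powr (- of_real b)) =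
           of_real (2 * pi * Gamma (a + b - 1) / (Gamma a * Gamma b * (c + r) powr (a + b - 1)))"
proof -
  let ?h = "\<lambda>u. complex_of_real (gamma_weight a c u)"
  let ?g = "\<lambda>u. complex_of_real (gamma_weight b r u)"
  have h_transform: "fourier_transform ?h s = of_real (Gamma a) * Complex c s powr (- of_real a)"
      for s
    using a c by (intro fourier_transform_gamma_weight) auto
  have g_transform: "fourier_transform ?g s = of_real (Gamma b) * Complex r s powr (- of_real b)"
      for s
    using b r by (intro fourier_transform_gamma_weight) auto
  have "(LINT s|lborel. fourier_transform ?h s * fourier_transform ?g (- s)) =
      2 * pi * (LINT u|lborel. ?h u * ?g u)"
  proof (rule fourier_parseval)
    show "integrable lborel ?h" "integrable lborel ?g"
      using has_bochner_integral_gamma_weight[of a c] has_bochner_integral_gamma_weight[of b r]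
        a b c r
      by (auto simp: has_bochner_integral_iff)
    show "norm (?h u) \<le> ((a - 1) / c) powr (a - 1)" for u
      using gamma_weight_bounded[OF a c] by simp
    show "isCont ?h u" for u
      using isCont_gamma_weight[OF a] by (intro continuous_intros)
    show "integrable lborel (fourier_transform ?h)"
      using integrable_Complex_powr[OF a c] by (simp add: h_transform [abs_def])
  qed
  moreover have "(LINT u|lborel. ?h u * ?g u) =
      of_real (Gamma (a + b - 1) / (c + r) powr (a + b - 1))"
    using has_bochner_integral_gamma_weight[of "a + b - 1" "c + r"] a b c r
    by (simp only: of_real_mult [symmetric] gamma_weight_mult integral_complex_of_real)
      (simp add: has_bochner_integral_iff)
  moreover have "(LINT s|lborel. fourier_transform ?h s * fourier_transform ?g (- s)) =
      of_real (Gamma a * Gamma b) *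
        (LINT s|lborel. Complex c s powr (- of_real a) * Complex r (- s) powr (- of_real b))"
    unfolding h_transform g_transform integral_mult_right_zero [symmetric] by (simp add: mult_ac)
  ultimately have "of_real (Gamma a * Gamma b) *
        (LINT s|lborel. Complex c s powr (- of_real a) * Complex r (- s) powr (- of_real b)) =
      of_real (2 * pi * (Gamma (a + b - 1) / (c + r) powr (a + b - 1)))"
    by simp
  moreover have "Gamma a \<noteq> 0" "Gamma b \<noteq> 0"
    using a b by (auto simp: Gamma_eq_zero_iff dest: nonpos_Ints_nonpos)
  ultimately show ?thesis using c r by (simp add: divide_simps mult_ac)
qed

section \<open>The incomplete beta function\<close>

lemma Beta_real_pos:
  assumes "a > 0" "b > (0::real)"
  shows "Beta a b > 0"
  unfolding Beta_def using assms by (intro divide_pos_pos mult_pos_pos Gamma_real_pos) auto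

definition beta_weight :: "real \<Rightarrow> real \<Rightarrow> real \<Rightarrow> real" where
  "beta_weight a b t = t powr (a - 1) * (1 - t) powr (b - 1)"

lemma beta_weight_nonneg: "0 \<le> beta_weight a b t"
  by (simp add: beta_weight_def)

lemma beta_weight_reflect: "beta_weight a b (1 - t) = beta_weight b a t"
  by (simp add: beta_weight_def)

lemma beta_weight_add_nat_left:
  assumes "0 \<le> t"
  shows "beta_weight (a + real k) b t = t ^ k * beta_weight a b t"
proof -
  have "t powr (a + real k - 1) = t ^ k * t powr (a - 1)"
    using assms by (cases "t = 0") (auto simp: powr_add powr_diff powr_realpow)
  thus ?thesis by (simp add: beta_weight_def)
qed

lemma inc_beta_has_integral:
  assumes "a > 0" "b > 0" "y \<le> 1"
  shows "(beta_weight a b has_integral Beta a b * inc_beta y a b) {0..y}"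
proof -
  have integrable: "set_integrable lborel {0..y} (beta_weight a b)"
    unfolding beta_weight_def [abs_def] using assms
    by (intro set_integrable_subset[OF integrable_Beta[of a b]]) auto
  have "Beta a b > 0" using assms by (intro Beta_real_pos)
  hence "Beta a b * inc_beta y a b = (LINT t:{0..y}|lborel. beta_weight a b t)"
    by (simp add: inc_beta_def beta_weight_def)
  thus ?thesis
    using set_borel_integral_eq_integral[OF integrable] by (simp add: has_integral_iff)
qed

lemma inc_beta_nonneg:
  assumes "a > 0" "b > 0" "y \<le> 1"
  shows "0 \<le> inc_beta y a b"
proof -
  have "0 \<le> Beta a b * inc_beta y a b"
    using inc_beta_has_integral[OF assms] by (rule has_integral_nonneg) (rule beta_weight_nonneg)
  thus ?thesis using Beta_real_pos[OF assms(1,2)] by (simp add: zero_le_mult_iff)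
qed

lemma inc_beta_reflect:
  assumes a: "a > 0" and b: "b > 0" and y: "0 \<le> y" "y \<le> 1"
  shows "inc_beta (1 - y) b a = 1 - inc_beta y a b"
proof -
  have "(beta_weight b a has_integral Beta a b * inc_beta (1 - y) b a) {0..1 - y}"
    using inc_beta_has_integral[OF b a, of "1 - y"] y by (simp add: Beta_commute[of b a])
  from has_integral_affinity[OF this [unfolded cbox_interval [symmetric]], of "- 1" 1]
  have upper: "(beta_weight a b has_integral Beta a b * inc_beta (1 - y) b a) {y..1}"
    by (simp add: image_affinity_atLeastAtMost beta_weight_reflect [of b a])
  have "(beta_weight a b has_integral
      Beta a b * inc_beta y a b + Beta a b * inc_beta (1 - y) b a) {0..1}"
    by (rule has_integral_combine[OF y inc_beta_has_integral[OF a b y(2)] upper])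
  hence "Beta a b * inc_beta y a b + Beta a b * inc_beta (1 - y) b a = Beta a b"
    using has_integral_Beta_real[OF a b] unfolding beta_weight_def [abs_def]
    by (rule has_integral_unique)
  hence "Beta a b * inc_beta (1 - y) b a = Beta a b * (1 - inc_beta y a b)"
    by (simp add: algebra_simps)
  thus ?thesis using Beta_real_pos[OF a b] by simp
qed

lemma inc_beta_le_1:
  assumes "a > 0" "b > 0" "0 \<le> y" "y \<le> 1"
  shows "inc_beta y a b \<le> 1"
  using inc_beta_reflect[OF assms] inc_beta_nonneg[of b a "1 - y"] assms by simp

lemma has_integral_beta_weight_diff:
  fixes a b y :: real
  assumes a: "a > 0" and b: "b > 0" and y: "0 \<le> y" "y \<le> 1"
  shows "((\<lambda>t. a * beta_weight a b t - (a + b) * beta_weight (a + 1) b t)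
           has_integral y powr a * (1 - y) powr b) {0..y}"
proof -
  have "((\<lambda>t. a * beta_weight a b t - (a + b) * beta_weight (a + 1) b t)
      has_integral (y powr a * (1 - y) powr b - 0 powr a * (1 - 0) powr b)) {0..y}"
  proof (rule fundamental_theorem_of_calculus_interior)
    show "continuous_on {0..y} (\<lambda>t. t powr a * (1 - t) powr b)"
      using a b y by (intro continuous_intros continuous_on_powr') auto
    fix t assume t: "t \<in> {0<..<y}"
    have "((\<lambda>t. t powr a * (1 - t) powr b) has_real_derivative
        a * t powr (a - 1) * (1 - t) powr b - b * (1 - t) powr (b - 1) * t powr a) (at t)"
      using t y by (auto intro!: derivative_eq_intros simp: field_simps)
    moreover have "(1 - t) powr b = (1 - t) powr (b - 1) * (1 - t)"
      and "t powr a = t powr (a - 1) * t"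
      using t y by (simp_all add: powr_diff)
    ultimately show "((\<lambda>t. t powr a * (1 - t) powr b) has_vector_derivative
        a * beta_weight a b t - (a + b) * beta_weight (a + 1) b t) (at t)"
      by (simp add: beta_weight_def has_real_derivative_iff_has_vector_derivative algebra_simps)
  qed (use y in auto)
  thus ?thesis by simp
qed

lemma inc_beta_plus1_left:
  assumes a: "a > 0" and b: "b > 0" and y: "0 \<le> y" "y \<le> 1"
  shows "inc_beta y a b = inc_beta y (a + 1) b +
           y powr a * (1 - y) powr b * (Gamma (a + b) / (Gamma (a + 1) * Gamma b))"
proof -
  have a_Int: "a \<notin> \<int>\<^sub>\<le>\<^sub>0" using a by (auto dest: nonpos_Ints_nonpos)
  have "((\<lambda>t. a * beta_weight a b t - (a + b) * beta_weight (a + 1) b t) has_integral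
      a * (Beta a b * inc_beta y a b) - (a + b) * (Beta (a + 1) b * inc_beta y (a + 1) b)) {0..y}"
    using a b y by (intro has_integral_diff has_integral_mult_right inc_beta_has_integral) auto
  hence "y powr a * (1 - y) powr b =
      a * (Beta a b * inc_beta y a b) - (a + b) * (Beta (a + 1) b * inc_beta y (a + 1) b)"
    by (rule has_integral_unique[OF has_integral_beta_weight_diff[OF a b y]])
  also have "(a + b) * (Beta (a + 1) b * inc_beta y (a + 1) b) =
      a * Beta a b * inc_beta y (a + 1) b"
    using Beta_plus1_left[OF a_Int, of b] by (simp only: mult.assoc [symmetric])
  finally have "inc_beta y a b =
      inc_beta y (a + 1) b + y powr a * (1 - y) powr b * (1 / (a * Beta a b))"
    using a Beta_real_pos[OF a b] by (simp add: field_simps)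
  also have "1 / (a * Beta a b) = Gamma (a + b) / (Gamma (a + 1) * Gamma b)"
    using Gamma_plus1[OF a_Int] by (simp add: Beta_def)
  finally show ?thesis .
qed

lemma inc_beta_pos:
  assumes a: "a > 0" and b: "b > 0" and y: "0 < y" "y < 1"
  shows "0 < inc_beta y a b"
proof -
  have "0 < y powr a * (1 - y) powr b * (Gamma (a + b) / (Gamma (a + 1) * Gamma b))"
    using a b y by (intro mult_pos_pos divide_pos_pos Gamma_real_pos) auto
  also have "\<dots> \<le> inc_beta y a b"
    using inc_beta_plus1_left[of a b y] inc_beta_nonneg[of "a + 1" b y] a b y by simp
  finally show ?thesis .
qed

lemma Beta_mult_inc_beta_add_nat_le:
  assumes a: "a > 0" and b: "b > 0" and y: "0 \<le> y" "y \<le> 1"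
  shows "Beta (a + real N) b * inc_beta y (a + real N) b \<le> y ^ N * (Beta a b * inc_beta y a b)"
proof (rule has_integral_le)
  show "(beta_weight (a + real N) b has_integral
      Beta (a + real N) b * inc_beta y (a + real N) b) {0..y}"
    using a b y by (intro inc_beta_has_integral) auto
  show "((\<lambda>t. y ^ N * beta_weight a b t) has_integral y ^ N * (Beta a b * inc_beta y a b)) {0..y}"
    using a b y by (intro has_integral_mult_right inc_beta_has_integral) auto
  show "beta_weight (a + real N) b t \<le> y ^ N * beta_weight a b t" if "t \<in> {0..y}" for t
    using that by (auto simp: beta_weight_add_nat_left beta_weight_nonneg
        intro!: mult_right_mono power_mono)
qed

lemma Beta_add_nat_ge:
  assumes a: "a > 0" and b: "b > 0" and y: "0 \<le> y" "y \<le> 1"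
  shows "y ^ N * (Beta a b * inc_beta (1 - y) b a) \<le> Beta (a + real N) b"
proof -
  have "y ^ N * (Beta b a * inc_beta (1 - y) b a) \<le>
      Beta b (a + real N) * inc_beta (1 - y) b (a + real N)"
  proof (rule has_integral_le)
    show "((\<lambda>t. y ^ N * beta_weight b a t) has_integral
        y ^ N * (Beta b a * inc_beta (1 - y) b a)) {0..1 - y}"
      using a b y by (intro has_integral_mult_right inc_beta_has_integral) auto
    show "(beta_weight b (a + real N) has_integral
        Beta b (a + real N) * inc_beta (1 - y) b (a + real N)) {0..1 - y}"
      using a b y by (intro inc_beta_has_integral) auto
    show "y ^ N * beta_weight b a t \<le> beta_weight b (a + real N) t" if "t \<in> {0..1 - y}" for t
    proof -
      have "y ^ N * beta_weight a b (1 - t) \<le> beta_weight (a + real N) b (1 - t)"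
        using that y by (auto simp: beta_weight_add_nat_left beta_weight_nonneg
            intro!: mult_right_mono power_mono)
      thus ?thesis by (simp only: beta_weight_reflect)
    qed
  qed
  also have "\<dots> \<le> Beta b (a + real N)"
    using inc_beta_le_1[of b "a + real N" "1 - y"] Beta_real_pos[of b "a + real N"] a b y
    by (simp add: mult_left_le)
  finally show ?thesis by (simp only: Beta_commute[of b])
qed

lemma inc_beta_add_nat_tendsto_0:
  assumes a: "a > 0" and b: "b > 0" and y: "0 \<le> y" "y < 1"
  shows "(\<lambda>N. inc_beta y (a + real N) b) \<longlonglongrightarrow> 0"
proof (rule tendsto_sandwich[of "\<lambda>_. 0"])
  \<comment> \<open>For \<open>y < r < 1\<close> the unnormalized integral is \<open>O(y\<^sup>N)\<close>, its normalization at least \<open>L r\<^sup>N\<close>.\<close>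
  define r where "r = (1 + y) / 2"
  define L where "L = Beta a b * inc_beta (1 - r) b a"
  have r: "y < r" "0 < r" "r < 1" using y by (auto simp: r_def)
  have L: "L > 0"
    unfolding L_def using a b r by (intro mult_pos_pos Beta_real_pos inc_beta_pos) auto
  have "(\<lambda>N. (y / r) ^ N) \<longlonglongrightarrow> 0" using y r by (intro LIMSEQ_realpow_zero) auto
  thus "(\<lambda>N. (y / r) ^ N * (Beta a b * inc_beta y a b / L)) \<longlonglongrightarrow> 0"
    by (rule tendsto_mult_left_zero)
  have "inc_beta y (a + real N) b \<le> (y / r) ^ N * (Beta a b * inc_beta y a b / L)" for N
  proof -
    have "r ^ N * L * inc_beta y (a + real N) b \<le> Beta (a + real N) b * inc_beta y (a + real N) b"
      using Beta_add_nat_ge[OF a b, of r N] inc_beta_nonneg[of "a + real N" b y] a b y r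
      by (intro mult_right_mono) (auto simp: L_def)
    also have "\<dots> \<le> y ^ N * (Beta a b * inc_beta y a b)"
      using a b y by (intro Beta_mult_inc_beta_add_nat_le) auto
    finally show ?thesis using r L by (simp add: power_divide field_simps)
  qed
  thus "\<forall>\<^sub>F N in sequentially. inc_beta y (a + real N) b \<le>
      (y / r) ^ N * (Beta a b * inc_beta y a b / L)"
    by simp
  show "\<forall>\<^sub>F N in sequentially. 0 \<le> inc_beta y (a + real N) b"
    using a b y by (intro always_eventually allI inc_beta_nonneg) auto
qed simp

section \<open>The incomplete beta function as a line integral\<close>

definition beta_kernel :: "real \<Rightarrow> real \<Rightarrow> real \<Rightarrow> complex \<Rightarrow> complex" where
  "beta_kernel a b y t = t powr (- of_real a) * (1 - t) powr (- of_real b) / (t - of_real y)"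

definition inc_beta_vline :: "real \<Rightarrow> real \<Rightarrow> real \<Rightarrow> real \<Rightarrow> complex" where
  "inc_beta_vline c y a b =
     of_real (y powr a * (1 - y) powr b) / (2 * of_real pi * \<i>) *
       vline_integral c (beta_kernel a b y)"

lemma borel_measurable_beta_kernel:
  assumes "0 < c" "c < 1" "c \<noteq> y"
  shows "(\<lambda>s. beta_kernel a b y (Complex c s)) \<in> borel_measurable borel"
  unfolding beta_kernel_def using assms
  by (intro borel_measurable_continuous_onI continuous_intros)
    (auto simp: complex_nonpos_Reals_iff complex_eq_iff)

lemma norm_le_mult_norm_diff_of_real:
  fixes t :: complex
  assumes y: "0 \<le> y" and t: "Re t \<noteq> y"
  shows "norm t \<le> (1 + y / \<bar>Re t - y\<bar>) * norm (t - of_real y)"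
proof -
  have "\<bar>Re t - y\<bar> \<le> norm (t - of_real y)"
    using abs_Re_le_cmod[of "t - of_real y"] by simp
  hence "y \<le> y / \<bar>Re t - y\<bar> * norm (t - of_real y)"
    using mult_left_mono[of "\<bar>Re t - y\<bar>" _ "y / \<bar>Re t - y\<bar>"] y t by simp
  moreover have "norm t \<le> norm (t - of_real y) + y"
    using norm_triangle_ineq[of "t - of_real y" "of_real y"] y by simp
  ultimately show ?thesis by (simp add: algebra_simps)
qed

lemma norm_beta_kernel:
  "norm (beta_kernel a b y t) =
      norm t powr (- a) * norm (1 - t) powr (- b) / norm (t - of_real y)"
  by (simp add: beta_kernel_def norm_mult norm_divide norm_powr_real_powr')

lemma norm_beta_kernel_le:
  assumes b: "b \<ge> 0" and y: "0 \<le> y" and t: "0 < Re t" "Re t < 1" "Re t \<noteq> y"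
  shows "norm (beta_kernel a b y t) \<le>
     (1 - Re t) powr (- b) * (1 + y / \<bar>Re t - y\<bar>) * norm t powr (- (a + 1))"
proof -
  have pos: "norm t > 0" "norm (t - of_real y) > 0" using t by auto
  have "norm (1 - t) powr (- b) \<le> (1 - Re t) powr (- b)"
    using abs_Re_le_cmod[of "1 - t"] b t by (intro powr_mono2') auto
  moreover have "1 / norm (t - of_real y) \<le> (1 + y / \<bar>Re t - y\<bar>) / norm t"
    using norm_le_mult_norm_diff_of_real[OF y t(3)] pos by (simp add: divide_simps mult_ac)
  ultimately have "norm t powr (- a) * norm (1 - t) powr (- b) * (1 / norm (t - of_real y)) \<le>
      norm t powr (- a) * (1 - Re t) powr (- b) * ((1 + y / \<bar>Re t - y\<bar>) / norm t)"
    by (intro mult_mono) auto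
  also have "\<dots> = (1 - Re t) powr (- b) * (1 + y / \<bar>Re t - y\<bar>) * norm t powr (- (a + 1))"
    using pos by (simp add: powr_diff powr_minus divide_simps)
  finally show ?thesis by (simp add: norm_beta_kernel)
qed

lemma norm_beta_kernel_add_le:
  assumes p: "p \<ge> 0" and t: "0 < Re t"
  shows "norm (beta_kernel (a + p) b y t) \<le> Re t powr (- p) * norm (beta_kernel a b y t)"
proof -
  have "norm t powr (- (a + p)) = norm t powr (- p) * norm t powr (- a)"
    by (simp only: minus_add_distrib powr_add mult.commute)
  hence "norm (beta_kernel (a + p) b y t) = norm t powr (- p) * norm (beta_kernel a b y t)"
    by (simp add: norm_beta_kernel)
  also have "norm t powr (- p) \<le> Re t powr (- p)"
    using abs_Re_le_cmod[of t] p t by (intro powr_mono2') auto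
  finally show ?thesis by (simp add: mult_right_mono)
qed

lemma vline_integrable_beta_kernel:
  assumes a: "a > 0" and b: "b \<ge> 0" and y: "0 \<le> y" and c: "0 < c" "c < 1" "c \<noteq> y"
  shows "vline_integrable c (beta_kernel a b y)"
  unfolding vline_integrable_def
proof (rule Bochner_Integration.integrable_bound)
  let ?w = "\<lambda>s. (1 - c) powr (- b) * (1 + y / \<bar>c - y\<bar>) * norm (Complex c s) powr (- (a + 1))"
  show "integrable lborel ?w"
    using a c by (intro integrable_mult_right integrable_norm_Complex_powr) auto
  have "norm (beta_kernel a b y (Complex c s)) \<le> ?w s" for s
    using norm_beta_kernel_le[of b y "Complex c s" a] b y c by simp
  thus "AE s in lborel. norm (beta_kernel a b y (Complex c s)) \<le> norm (?w s)"
    by (intro AE_I2) (auto intro: order_trans[OF _ abs_ge_self])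
qed (use borel_measurable_beta_kernel[OF c] in simp)

lemma beta_kernel_plus1_left:
  assumes "t \<noteq> 0" and "t \<noteq> of_real y"
  shows "beta_kernel a b y t =
           of_real y * beta_kernel (a + 1) b y t +
           t powr (- of_real (a + 1)) * (1 - t) powr (- of_real b)"
proof -
  have "t powr (- of_real a) = t powr (1 + - of_real (a + 1))" by simp
  also have "\<dots> = t * t powr (- of_real (a + 1))"
    using assms by (simp only: powr_add) (simp add: powr_def)
  finally show ?thesis
    using assms unfolding beta_kernel_def by (simp add: field_simps)
qed

lemma vline_integral_beta_kernel_plus1_left:
  assumes a: "a > 0" and b: "b > 0" and y: "0 \<le> y" and c: "0 < c" "c < 1" "c \<noteq> y"
  shows "vline_integral c (beta_kernel a b y) =
           of_real y * vline_integral c (beta_kernel (a + 1) b y) +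
           2 * of_real pi * \<i> * of_real (Gamma (a + b) / (Gamma (a + 1) * Gamma b))"
proof -
  let ?K = "\<lambda>s. Complex c s powr (- of_real (a + 1)) * (1 - Complex c s) powr (- of_real b)"
  have split: "beta_kernel a b y (Complex c s) =
      of_real y * beta_kernel (a + 1) b y (Complex c s) + ?K s" for s
    using c by (intro beta_kernel_plus1_left) (auto simp: complex_eq_iff)
  have integrable: "integrable lborel (\<lambda>s. beta_kernel a b y (Complex c s))"
    "integrable lborel (\<lambda>s. of_real y * beta_kernel (a + 1) b y (Complex c s))"
    using vline_integrable_beta_kernel[of a b y c]
      vline_integrable_beta_kernel[of "a + 1" b y c] a b y c
    by (auto simp: vline_integrable_def)
  have "integrable lborel
      (\<lambda>s. beta_kernel a b y (Complex c s) - of_real y * beta_kernel (a + 1) b y (Complex c s))"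
    using integrable by (rule Bochner_Integration.integrable_diff)
  hence "integrable lborel ?K" by (simp add: split)
  hence "(LINT s|lborel. beta_kernel a b y (Complex c s)) =
      of_real y * (LINT s|lborel. beta_kernel (a + 1) b y (Complex c s)) + (LINT s|lborel. ?K s)"
    using integrable(2)
    by (simp only: split Bochner_Integration.integral_add integral_mult_right_zero)
  moreover have "1 - Complex c s = Complex (1 - c) (- s)" for s by (simp add: complex_eq_iff)
  hence "(LINT s|lborel. ?K s) = of_real (2 * pi * Gamma (a + b) / (Gamma (a + 1) * Gamma b))"
    using cauchy_beta_integral[of "a + 1" b c "1 - c"] a b c by simp
  ultimately show ?thesis by (simp add: vline_integral_def algebra_simps)
qed

lemma inc_beta_vline_plus1_left:
  assumes "a > 0" and "b > 0" and "0 < y" and "0 < c" "c < 1" "c \<noteq> y"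
  shows "inc_beta_vline c y a b = inc_beta_vline c y (a + 1) b +
           of_real (y powr a * (1 - y) powr b * (Gamma (a + b) / (Gamma (a + 1) * Gamma b)))"
proof -
  have "y powr (a + 1) = y * y powr a" using assms by (simp add: powr_add)
  thus ?thesis
    using vline_integral_beta_kernel_plus1_left[of a b y c] assms
    by (simp add: inc_beta_vline_def field_simps)
qed

lemma inc_beta_vline_add_nat_tendsto_0:
  assumes a: "a > 0" and b: "b > 0" and y: "0 < y" "y < c" and c: "c < 1"
  shows "(\<lambda>N. inc_beta_vline c y (a + real N) b) \<longlonglongrightarrow> 0"
proof (rule Lim_null_comparison)
  define B where "B = (LINT s|lborel. norm (beta_kernel a b y (Complex c s)))"
  define C where "C = y powr a * (1 - y) powr b / (2 * pi)"
  have "(\<lambda>N. (y / c) ^ N) \<longlonglongrightarrow> 0" using y by (intro LIMSEQ_realpow_zero) auto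
  thus "(\<lambda>N. (y / c) ^ N * (C * B)) \<longlonglongrightarrow> 0"
    by (rule tendsto_mult_left_zero)
  have "norm (inc_beta_vline c y (a + real N) b) \<le> (y / c) ^ N * (C * B)" for N
  proof -
    have integrable: "integrable lborel (\<lambda>s. beta_kernel (a + real M) b y (Complex c s))" for M
      using vline_integrable_beta_kernel[of "a + real M" b y c] a b c y
      by (simp add: vline_integrable_def)
    have "norm (vline_integral c (beta_kernel (a + real N) b y)) \<le>
        (LINT s|lborel. norm (beta_kernel (a + real N) b y (Complex c s)))"
      by (simp add: vline_integral_def norm_mult)
    also have "\<dots> \<le> (LINT s|lborel. c powr (- real N) * norm (beta_kernel a b y (Complex c s)))"
    proof (rule integral_mono)
      show "norm (beta_kernel (a + real N) b y (Complex c s)) \<le>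
          c powr (- real N) * norm (beta_kernel a b y (Complex c s))" for s
        using norm_beta_kernel_add_le[of "real N" "Complex c s" a b y] y by simp
    qed (use integrable[of N] integrable[of 0] in auto)
    also have "\<dots> = B / c ^ N"
      using y by (simp add: B_def powr_minus powr_realpow divide_inverse)
    finally have "norm (vline_integral c (beta_kernel (a + real N) b y)) \<le> B / c ^ N" .
    hence "norm (inc_beta_vline c y (a + real N) b) \<le>
        y powr (a + real N) * (1 - y) powr b / (2 * pi) * (B / c ^ N)"
      unfolding inc_beta_vline_def norm_mult
      by (intro mult_mono) (simp_all add: norm_divide norm_mult)
    also have "\<dots> = (y / c) ^ N * (C * B)"
      using y by (simp add: C_def powr_add powr_realpow power_divide field_simps)
    finally show ?thesis .
  qed
  thus "\<forall>\<^sub>F N in sequentially. norm (inc_beta_vline c y (a + real N) b) \<le> (y / c) ^ N * (C * B)"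
    by simp
qed

lemma inc_beta_vline_right:
  assumes a: "a > 0" and b: "b > 0" and y: "0 < y" "y < c" and c: "c < 1"
  shows "inc_beta_vline c y a b = of_real (inc_beta y a b)"
proof -
  define D where "D = (\<lambda>a. inc_beta_vline c y a b - of_real (inc_beta y a b))"
  have "D (a + real N) = D a" for N
  proof (induction N)
    case (Suc N)
    have "D (a + real N) = D (a + real N + 1)"
      using inc_beta_vline_plus1_left[of "a + real N" b y c]
        inc_beta_plus1_left[of "a + real N" b y] a b y c
      by (simp add: D_def)
    thus ?case using Suc by (simp add: add_ac)
  qed simp
  moreover have "(\<lambda>N. D (a + real N)) \<longlonglongrightarrow> 0 - of_real 0"
    unfolding D_def using a b y c
    by (intro tendsto_diff tendsto_of_real inc_beta_vline_add_nat_tendsto_0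
      inc_beta_add_nat_tendsto_0) auto
  ultimately have "D a = 0" by (simp add: LIMSEQ_const_iff)
  thus ?thesis by (simp add: D_def)
qed

lemma vline_integral_reflect: "vline_integral (1 - c) (\<lambda>t. f (1 - t)) = vline_integral c f"
proof -
  have "1 - Complex (1 - c) (- s) = Complex c s" for s by (simp add: complex_eq_iff)
  thus ?thesis
    unfolding vline_integral_def by (subst lborel_integral_real_affine[of "- 1" _ 0]) auto
qed

lemma inc_beta_vline_reflect: "inc_beta_vline (1 - c) (1 - y) b a = - inc_beta_vline c y a b"
proof -
  have "beta_kernel b a (1 - y) = (\<lambda>t. - beta_kernel a b y (1 - t))"
  proof
    fix t :: complex
    have "t - of_real (1 - y) = - (1 - t - of_real y)" by simp
    thus "beta_kernel b a (1 - y) t = - beta_kernel a b y (1 - t)"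
      by (simp only: beta_kernel_def diff_diff_eq2 add_diff_cancel_left' mult.commute
        divide_minus_right)
  qed
  hence "vline_integral (1 - c) (beta_kernel b a (1 - y)) =
      vline_integral (1 - c) (\<lambda>t. - beta_kernel a b y (1 - t))"
    by simp
  also have "\<dots> = - vline_integral c (beta_kernel a b y)"
    using vline_integral_reflect[of c "\<lambda>t. - beta_kernel a b y t"]
    by (simp add: vline_integral_def)
  finally show ?thesis by (simp add: inc_beta_vline_def mult_ac)
qed

lemma inc_beta_vline_left:
  assumes "a > 0" and "b > 0" and "0 < c" and "c < y" and "y < 1"
  shows "inc_beta_vline c y a b = of_real (inc_beta y a b - 1)"
proof -
  have "inc_beta_vline (1 - c) (1 - y) b a = of_real (inc_beta (1 - y) b a)"
    using assms by (intro inc_beta_vline_right) auto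
  thus ?thesis
    using inc_beta_reflect[of a b y] assms by (simp add: inc_beta_vline_reflect algebra_simps)
qed

section \<open>The kernel of the noncentral t-distribution\<close>

lemma csqrt_of_real_divide:
  assumes "x \<ge> 0" and t: "Re t > 0"
  shows "csqrt (of_real x / t) = of_real (sqrt x) / csqrt t"
proof (cases "x = 0")
  case False
  hence x: "x > 0" using assms by simp
  show ?thesis
  proof (rule csqrt_unique)
    have "Re (csqrt t) > 0" using t by (simp add: add_nonneg_pos)
    hence "0 < Re (of_real (sqrt x) / csqrt t)"
      using x by (auto simp: Re_divide intro!: divide_pos_pos mult_pos_pos add_pos_nonneg)
    thus "0 < Re (of_real (sqrt x) / csqrt t) \<or>
        Re (of_real (sqrt x) / csqrt t) = 0 \<and> 0 \<le> Im (of_real (sqrt x) / csqrt t)" ..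
    show "(of_real (sqrt x) / csqrt t)\<^sup>2 = of_real x / t"
      using x by (simp add: power_divide flip: of_real_power)
  qed
qed simp

lemma inverse_csqrt_power:
  assumes "t \<noteq> 0"
  shows "1 / csqrt t ^ k = t powr (- of_real (real k / 2))"
proof -
  have "csqrt t ^ k = exp (of_nat k * (1 / 2 * Ln t))"
    using assms by (simp only: exp_of_nat_mult csqrt_conv_powr powr_def if_False)
  moreover have "t powr (- of_real (real k / 2)) = exp (- (of_nat k * (1 / 2 * Ln t)))"
    using assms by (simp add: powr_def)
  ultimately show ?thesis by (simp only: exp_minus inverse_eq_divide)
qed

lemma nct_kernel_eq_erfcx:
  assumes y: "y \<ge> 0" and t: "Re t > 0"
  shows "nct_kernel n \<delta> y t =
    erfcx (of_real (\<delta> * sqrt (y / 2)) / csqrt t) / (csqrt t * (1 - t) powr of_real (n / 2))"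
proof -
  have "csqrt (of_real y / (2 * t)) = of_real (sqrt (y / 2)) / csqrt t"
    using csqrt_of_real_divide[of "y / 2" t] y t by simp
  hence arg: "of_real \<delta> * csqrt (of_real y / (2 * t)) = of_real (\<delta> * sqrt (y / 2)) / csqrt t"
    by simp
  have "(\<delta> * sqrt (y / 2))\<^sup>2 = \<delta>\<^sup>2 * y / 2" using y by (simp add: power_mult_distrib)
  hence "(complex_of_real (\<delta> * sqrt (y / 2)))\<^sup>2 = of_real (\<delta>\<^sup>2 * y / 2)"
    by (simp only: of_real_power [symmetric])
  hence "1 / (2 * t) * of_real (\<delta>\<^sup>2 * y) = (of_real (\<delta> * sqrt (y / 2)) / csqrt t)\<^sup>2"
    by (simp only: power_divide power2_csqrt) simp
  thus ?thesis unfolding nct_kernel_def erfcx_def arg by simp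
qed

lemma nct_kernel_sums:
  assumes y: "y \<ge> 0" and t: "Re t > 0"
  shows "(\<lambda>k. of_real (erfcx_coeff k * (\<delta> * sqrt (y / 2)) ^ k) *
      beta_kernel (1 / 2 + real k / 2) (n / 2) y t)
           sums (nct_kernel n \<delta> y t / (t - of_real y))"
proof -
  let ?w = "of_real (\<delta> * sqrt (y / 2)) / csqrt t"
  define r where "r = (1 - t) powr (- of_real (n / 2)) / (t - of_real y)"
  have t0: "t \<noteq> 0" using t by auto
  have "(\<lambda>k. of_real (erfcx_coeff k) * ?w ^ k * (1 / csqrt t * r)) sums
      (erfcx ?w * (1 / csqrt t * r))"
    by (intro sums_mult2 erfcx_sums)
  also have "erfcx ?w * (1 / csqrt t * r) = nct_kernel n \<delta> y t / (t - of_real y)"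
    unfolding nct_kernel_eq_erfcx[OF y t] r_def powr_minus
    by (simp only: divide_inverse inverse_mult_distrib mult_ac mult_1)
  also have "(\<lambda>k. of_real (erfcx_coeff k) * ?w ^ k * (1 / csqrt t * r)) =
      (\<lambda>k. of_real (erfcx_coeff k * (\<delta> * sqrt (y / 2)) ^ k) *
        beta_kernel (1 / 2 + real k / 2) (n / 2) y t)"
  proof
    fix k
    have "of_real (erfcx_coeff k) * ?w ^ k * (1 / csqrt t * r) =
        of_real (erfcx_coeff k * (\<delta> * sqrt (y / 2)) ^ k) * (1 / csqrt t ^ Suc k * r)"
      by (simp add: power_divide mult_ac)
    also have "1 / csqrt t ^ Suc k * r = beta_kernel (1 / 2 + real k / 2) (n / 2) y t"
      unfolding inverse_csqrt_power[OF t0] beta_kernel_def r_def by (simp add: add_divide_distrib)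
    finally show "of_real (erfcx_coeff k) * ?w ^ k * (1 / csqrt t * r) =
        of_real (erfcx_coeff k * (\<delta> * sqrt (y / 2)) ^ k) *
          beta_kernel (1 / 2 + real k / 2) (n / 2) y t" .
  qed
  finally show ?thesis .
qed

lemma sum_norm_le_suminf_mult:
  fixes f :: "nat \<Rightarrow> 'a::real_normed_vector"
  assumes bound: "\<And>k. norm (f k) \<le> B k * x" and B: "summable B" "\<And>k. 0 \<le> B k" and x: "0 \<le> x"
  shows "(\<Sum>k<N. norm (f k)) \<le> (\<Sum>k. B k) * x"
proof -
  have "(\<Sum>k<N. norm (f k)) \<le> (\<Sum>k<N. B k) * x"
    unfolding sum_distrib_right by (intro sum_mono bound)
  also have "\<dots> \<le> (\<Sum>k. B k) * x"
    using B x by (intro mult_right_mono sum_le_suminf) auto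
  finally show ?thesis .
qed

lemma norm_beta_kernel_half_nat_le:
  assumes "0 < Re t"
  shows "norm (beta_kernel (a + real k / 2) b y t) \<le>
      (Re t powr (- (1 / 2))) ^ k * norm (beta_kernel a b y t)"
proof -
  have "Re t powr (- (1 / 2) * real k) = (Re t powr (- (1 / 2))) ^ k"
    using assms unfolding powr_powr [symmetric] by (simp add: powr_realpow)
  thus ?thesis using norm_beta_kernel_add_le[of "real k / 2" t a b y] assms by simp
qed

lemma
  assumes n: "n \<ge> 0" and y: "y \<ge> 0" and c: "0 < c" "c < 1" "c \<noteq> y"
  shows vline_integrable_nct_kernel:
      "vline_integrable c (\<lambda>t. nct_kernel n \<delta> y t / (t - of_real y))"
    and vline_integral_nct_kernel_sums:
      "(\<lambda>k. of_real (erfcx_coeff k * (\<delta> * sqrt (y / 2)) ^ k) *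
          vline_integral c (beta_kernel (1 / 2 + real k / 2) (n / 2) y)) sums
         vline_integral c (\<lambda>t. nct_kernel n \<delta> y t / (t - of_real y))"
proof -
  define w where "w = \<delta> * sqrt (y / 2)"
  define f where "f = (\<lambda>k s. of_real (erfcx_coeff k * w ^ k) *
      beta_kernel (1 / 2 + real k / 2) (n / 2) y (Complex c s))"
  define B where "B = (\<lambda>k. norm (erfcx_coeff k * (w * c powr (- (1 / 2))) ^ k))"
  define g where "g = (\<lambda>s. norm (beta_kernel (1 / 2) (n / 2) y (Complex c s)))"
  have measurable_f: "f k \<in> borel_measurable lborel" for k
    unfolding f_def using borel_measurable_beta_kernel[OF c] by simp
  have integrable_g: "integrable lborel (\<lambda>s. (\<Sum>k. B k) * g s)"
    using vline_integrable_beta_kernel[of "1 / 2" "n / 2" y c] n y c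
    by (simp add: vline_integrable_def g_def)
  have "norm (f k s) \<le> \<bar>erfcx_coeff k * w ^ k\<bar> * ((c powr (- (1 / 2))) ^ k * g s)" for k s
    using norm_beta_kernel_half_nat_le[of "Complex c s"] c
    unfolding f_def g_def norm_mult norm_of_real by (intro mult_left_mono) auto
  hence norm_f: "norm (f k s) \<le> B k * g s" for k s
    by (simp add: B_def abs_mult power_mult_distrib mult.assoc)
  have "summable B" unfolding B_def by (rule summable_norm_erfcx_coeff)
  hence bound: "(\<Sum>k<N. norm (f k s)) \<le> (\<Sum>k. B k) * g s" for N s
    by (intro sum_norm_le_suminf_mult norm_f) (auto simp: B_def g_def)
  have suminf_f: "(\<Sum>k. f k s) = nct_kernel n \<delta> y (Complex c s) / (Complex c s - of_real y)" for s
    using nct_kernel_sums[of y "Complex c s" \<delta> n] y c by (simp add: f_def w_def sums_iff)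
  note dominated = measurable_f integrable_g bound
  show "vline_integrable c (\<lambda>t. nct_kernel n \<delta> y t / (t - of_real y))"
    using integrable_suminf_dominated[OF dominated] by (simp add: vline_integrable_def suminf_f)
  have "(\<lambda>k. \<i> * (LINT s|lborel. f k s)) sums
      vline_integral c (\<lambda>t. nct_kernel n \<delta> y t / (t - of_real y))"
    using sums_mult[OF sums_integral_dominated[OF dominated], of \<i>]
    by (simp add: vline_integral_def suminf_f)
  thus "(\<lambda>k. of_real (erfcx_coeff k * (\<delta> * sqrt (y / 2)) ^ k) *
          vline_integral c (beta_kernel (1 / 2 + real k / 2) (n / 2) y)) sums
      vline_integral c (\<lambda>t. nct_kernel n \<delta> y t / (t - of_real y))"
    by (simp add: f_def w_def vline_integral_def mult_ac)
qed

definition nct_coeff :: "real \<Rightarrow> nat \<Rightarrow> real" where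
  "nct_coeff \<delta> k = 1 / 2 * exp (- (\<delta>\<^sup>2 / 2)) * (erfcx_coeff k * (\<delta> / sqrt 2) ^ k)"

definition nct_vline :: "real \<Rightarrow> real \<Rightarrow> real \<Rightarrow> real \<Rightarrow> complex" where
  "nct_vline c n \<delta> y =
     of_real (1 / 2 * exp (- (\<delta>\<^sup>2 / 2))) *
     (of_real (sqrt y * (1 - y) powr (n / 2)) / (2 * of_real pi * \<i>)) *
     vline_integral c (\<lambda>t. nct_kernel n \<delta> y t / (t - of_real y))"

lemma nct_vline_sums:
  assumes n: "n \<ge> 0" and y: "y > 0" and c: "0 < c" "c < 1" "c \<noteq> y"
  shows "(\<lambda>k. of_real (nct_coeff \<delta> k) * inc_beta_vline c y (1 / 2 + real k / 2) (n / 2)) sums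
           nct_vline c n \<delta> y"
proof -
  let ?I = "\<lambda>k. vline_integral c (beta_kernel (1 / 2 + real k / 2) (n / 2) y)"
  let ?C = "of_real (1 / 2 * exp (- (\<delta>\<^sup>2 / 2))) *
    (of_real (sqrt y * (1 - y) powr (n / 2)) / (2 * of_real pi * \<i>))"
  have "(\<lambda>k. ?C * (of_real (erfcx_coeff k * (\<delta> * sqrt (y / 2)) ^ k) * ?I k)) sums
      nct_vline c n \<delta> y"
    unfolding nct_vline_def using n y c by (intro sums_mult vline_integral_nct_kernel_sums) auto
  moreover have "?C * (of_real (erfcx_coeff k * (\<delta> * sqrt (y / 2)) ^ k) * ?I k) =
      of_real (nct_coeff \<delta> k) * inc_beta_vline c y (1 / 2 + real k / 2) (n / 2)" for k
  proof -
    have "y powr (1 / 2 * real k) = sqrt y ^ k"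
      using y unfolding powr_powr [symmetric] by (simp add: powr_half_sqrt powr_realpow)
    hence "y powr (1 / 2 + real k / 2) = sqrt y * sqrt y ^ k"
      using y by (simp add: powr_add powr_half_sqrt)
    moreover have "(\<delta> * sqrt (y / 2)) ^ k = (\<delta> / sqrt 2) ^ k * sqrt y ^ k"
      by (simp add: real_sqrt_divide power_mult_distrib power_divide)
    ultimately show ?thesis by (simp add: inc_beta_vline_def nct_coeff_def)
  qed
  ultimately show ?thesis by simp
qed

section \<open>The series of the noncentral t-distribution\<close>

lemma
  fixes f :: "nat \<Rightarrow> 'a::banach"
  assumes "summable (\<lambda>k. norm (f k))"
  shows summable_even_terms: "summable (\<lambda>j. f (2 * j))"
    and summable_odd_terms: "summable (\<lambda>j. f (2 * j + 1))"
proof -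
  have "summable (\<lambda>j. f (g j))" if "inj g" for g :: "nat \<Rightarrow> nat"
  proof -
    have "summable ((\<lambda>k. norm (f k)) \<circ> g)"
      using assms that by (intro summable_reindex) auto
    thus ?thesis by (intro summable_norm_cancel[of "\<lambda>j. f (g j)"]) (simp add: o_def)
  qed
  from this[of "\<lambda>j. 2 * j"] this[of "\<lambda>j. 2 * j + 1"]
  show "summable (\<lambda>j. f (2 * j))" "summable (\<lambda>j. f (2 * j + 1))"
    by (auto simp: inj_def)
qed

lemma sums_even_plus_odd:
  fixes f :: "nat \<Rightarrow> real"
  assumes "summable (\<lambda>k. norm (f k))"
  shows "f sums ((\<Sum>j. f (2 * j)) + (\<Sum>j. f (2 * j + 1)))"
proof -
  have "(\<lambda>k. if even k then f (2 * (k div 2)) else f (2 * ((k - 1) div 2) + 1)) sums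
      ((\<Sum>j. f (2 * j + 1)) + (\<Sum>j. f (2 * j)))"
    using summable_even_terms[OF assms] summable_odd_terms[OF assms]
    by (intro sums_if summable_sums)
  also have "(\<lambda>k. if even k then f (2 * (k div 2)) else f (2 * ((k - 1) div 2) + 1)) = f"
    by (auto simp: fun_eq_iff elim!: oddE evenE)
  finally show ?thesis by (simp only: add.commute)
qed

lemma nct_coeff_even: "nct_coeff \<delta> (2 * j) = 1 / 2 * exp (- (\<delta>\<^sup>2 / 2)) * ((\<delta>\<^sup>2 / 2) ^ j / fact j)"
  unfolding nct_coeff_def erfcx_coeff_even by (simp add: power_mult power_divide)

lemma nct_coeff_odd:
  "nct_coeff \<delta> (2 * j + 1) =
     - (1 / 2 * exp (- (\<delta>\<^sup>2 / 2)) * (\<delta> / sqrt 2 * ((\<delta>\<^sup>2 / 2) ^ j / Gamma (real j + 3 / 2))))"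
proof -
  have power: "(\<delta> / sqrt 2) ^ (2 * j) = (\<delta>\<^sup>2 / 2) ^ j" by (simp add: power_mult power_divide)
  show ?thesis unfolding nct_coeff_def erfcx_coeff_odd power_add power by (simp add: mult_ac)
qed

lemma nct_coeff_sums: "nct_coeff \<delta> sums (1 / 2 * erfc (\<delta> / sqrt 2))"
proof -
  have "exp (- (\<delta>\<^sup>2 / 2)) * erfcx (\<delta> / sqrt 2) = erfc (\<delta> / sqrt 2)"
    by (simp add: erfcx_def power_divide mult_exp_exp flip: mult.assoc)
  thus ?thesis
    using sums_mult[OF erfcx_sums[of "\<delta> / sqrt 2"], of "1 / 2 * exp (- (\<delta>\<^sup>2 / 2))"]
    by (simp add: nct_coeff_def [abs_def])
qed

lemma summable_norm_nct_coeff: "summable (\<lambda>k. norm (nct_coeff \<delta> k))"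
  using summable_mult[OF summable_norm_erfcx_coeff[of "\<delta> / sqrt 2"],
      of "1 / 2 * exp (- (\<delta>\<^sup>2 / 2))"]
  by (simp add: nct_coeff_def abs_mult)

lemma summable_norm_nct_coeff_mult_inc_beta:
  assumes "b > 0" "0 \<le> y" "y \<le> 1"
  shows "summable (\<lambda>k. norm (nct_coeff \<delta> k * inc_beta y (1 / 2 + real k / 2) b))"
proof (rule summable_comparison_test'[OF summable_norm_nct_coeff[of \<delta>]])
  fix k
  let ?a = "1 / 2 + real k / 2"
  have "\<bar>inc_beta y ?a b\<bar> \<le> 1"
    using inc_beta_nonneg[of ?a b y] inc_beta_le_1[of ?a b y] assms by simp
  thus "norm (norm (nct_coeff \<delta> k * inc_beta y ?a b)) \<le> norm (nct_coeff \<delta> k)"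
    by (simp add: abs_mult mult_left_le)
qed

lemma nct_P_minus_nct_Q_sums:
  assumes n: "n > 0" and y: "y = x\<^sup>2 / (n + x\<^sup>2)"
  shows "(\<lambda>k. nct_coeff \<delta> k * inc_beta y (1 / 2 + real k / 2) (n / 2)) sums
      (nct_P n x \<delta> - nct_Q n x \<delta>)"
proof -
  define h where "h = 1 / 2 * exp (- (\<delta>\<^sup>2 / 2))"
  define f where "f = (\<lambda>k. nct_coeff \<delta> k * inc_beta y (1 / 2 + real k / 2) (n / 2))"
  let ?p = "\<lambda>j. (\<delta>\<^sup>2 / 2) ^ j / fact j * inc_beta y (real j + 1 / 2) (n / 2)"
  let ?q = "\<lambda>j. \<delta> / sqrt 2 * ((\<delta>\<^sup>2 / 2) ^ j / Gamma (real j + 3 / 2)) *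
    inc_beta y (real j + 1) (n / 2)"
  have "h \<noteq> 0" by (simp add: h_def)
  have "0 \<le> y" "y \<le> 1" using n y by (auto simp: divide_le_eq add_pos_nonneg)
  hence summable_f: "summable (\<lambda>k. norm (f k))"
    unfolding f_def using n by (intro summable_norm_nct_coeff_mult_inc_beta) auto
  have f_even: "f (2 * j) = h * ?p j" for j
    unfolding f_def nct_coeff_even h_def by (simp add: add.commute)
  have f_odd: "f (2 * j + 1) = - h * ?q j" for j
  proof -
    have index: "1 / 2 + real (2 * j + 1) / 2 = real j + 1" by (simp add: field_simps)
    show ?thesis unfolding f_def nct_coeff_odd index h_def by (simp add: mult_ac)
  qed
  have "summable ?p" "summable ?q"
    using summable_even_terms[OF summable_f] summable_odd_terms[OF summable_f] \<open>h \<noteq> 0\<close>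
    unfolding f_even f_odd by (simp_all only: summable_cmult_iff neg_equal_0_iff_equal simp_thms)
  hence "(\<Sum>j. f (2 * j)) = nct_P n x \<delta>" "(\<Sum>j. f (2 * j + 1)) = - nct_Q n x \<delta>"
    unfolding f_even f_odd nct_P_def nct_Q_def Let_def y [symmetric]
    by (simp_all only: suminf_mult) (simp_all add: h_def)
  thus ?thesis
    using sums_even_plus_odd[OF summable_f] by (simp add: f_def)
qed

lemma nct_vline_right:
  assumes n: "n > 0" and y: "y = x\<^sup>2 / (n + x\<^sup>2)" and c: "0 < y" "y < c" "c < 1"
  shows "nct_vline c n \<delta> y = of_real (nct_P n x \<delta> - nct_Q n x \<delta>)"
proof (rule sums_unique2)
  let ?I = "\<lambda>k. inc_beta y (1 / 2 + real k / 2) (n / 2)"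
  have "inc_beta_vline c y (1 / 2 + real k / 2) (n / 2) = of_real (?I k)" for k
    using n c by (intro inc_beta_vline_right) auto
  thus "(\<lambda>k. complex_of_real (nct_coeff \<delta> k * ?I k)) sums nct_vline c n \<delta> y"
    using nct_vline_sums[of n y c \<delta>] n c by simp
  show "(\<lambda>k. complex_of_real (nct_coeff \<delta> k * ?I k)) sums of_real (nct_P n x \<delta> - nct_Q n x \<delta>)"
    by (rule sums_of_real[OF nct_P_minus_nct_Q_sums[OF n y]])
qed

lemma nct_vline_left:
  assumes n: "n > 0" and y: "y = x\<^sup>2 / (n + x\<^sup>2)" "y < 1" and d: "0 < d" "d < y"
  shows "nct_vline d n \<delta> y = - of_real (nct_R n x \<delta>)"
proof (rule sums_unique2)
  let ?I = "\<lambda>k. inc_beta y (1 / 2 + real k / 2) (n / 2)"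
  have "inc_beta_vline d y (1 / 2 + real k / 2) (n / 2) = of_real (?I k - 1)" for k
    using n y d by (intro inc_beta_vline_left) auto
  thus "(\<lambda>k. complex_of_real (nct_coeff \<delta> k * (?I k - 1))) sums nct_vline d n \<delta> y"
    using nct_vline_sums[of n y d \<delta>] n y(2) d by simp
  have "(\<lambda>k. nct_coeff \<delta> k * ?I k - nct_coeff \<delta> k) sums
      (nct_P n x \<delta> - nct_Q n x \<delta> - 1 / 2 * erfc (\<delta> / sqrt 2))"
    by (intro sums_diff nct_coeff_sums nct_P_minus_nct_Q_sums n y)
  hence "(\<lambda>k. nct_coeff \<delta> k * (?I k - 1)) sums - nct_R n x \<delta>"
    by (simp add: nct_R_def algebra_simps)
  from sums_of_real[OF this]
  show "(\<lambda>k. complex_of_real (nct_coeff \<delta> k * (?I k - 1))) sums - of_real (nct_R n x \<delta>)"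
    by simp
qed

theorem lemma3p1:
  fixes n x \<delta> y c d :: real
  assumes "n > 0" and "x > 0" and "y = x\<^sup>2 / (n + x\<^sup>2)"
    and "0 < y" and "y < c" and "c < 1"
    and "0 < d" and "d < y" and "y < 1"
  shows
   "(nct_F n x \<delta> = 2 * nct_P n x \<delta> + nct_R n x \<delta>) \<and>
    (nct_R n x \<delta> = 1/2 * erfc (\<delta> / sqrt 2) + nct_Q n x \<delta> - nct_P n x \<delta>) \<and>
    (vline_integrable c (\<lambda>t. nct_kernel n \<delta> y t / (t - of_real y))) \<and>
    (complex_of_real (nct_R n x \<delta>) =
        of_real (1/2 * erfc (\<delta> / sqrt 2)) -
        of_real (1/2 * exp (- (\<delta>\<^sup>2 / 2))) *
          (of_real (sqrt y * (1 - y) powr (n / 2)) / (2 * of_real pi * \<i>)) *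
          vline_integral c (\<lambda>t. nct_kernel n \<delta> y t / (t - of_real y))) \<and>
    (vline_integrable d (\<lambda>t. nct_kernel n \<delta> y t / (of_real y - t))) \<and>
    (complex_of_real (nct_R n x \<delta>) =
        of_real (1/2 * exp (- (\<delta>\<^sup>2 / 2))) *
          (of_real (sqrt y * (1 - y) powr (n / 2)) / (2 * of_real pi * \<i>)) *
          vline_integral d (\<lambda>t. nct_kernel n \<delta> y t / (of_real y - t)))"
proof -
  let ?f = "\<lambda>t. nct_kernel n \<delta> y t / (t - of_real y)"
  have flip: "(\<lambda>t. nct_kernel n \<delta> y t / (of_real y - t)) = (\<lambda>t. - ?f t)"
    by (metis minus_diff_eq divide_minus_right)
  have integrable: "vline_integrable c ?f" "vline_integrable d (\<lambda>t. - ?f t)"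
    using vline_integrable_nct_kernel[of n y c \<delta>] vline_integrable_nct_kernel[of n y d \<delta>]
      assms(1,4-9)
    by (auto simp: vline_integrable_def)
  have R: "nct_R n x \<delta> = 1/2 * erfc (\<delta> / sqrt 2) - (nct_P n x \<delta> - nct_Q n x \<delta>)"
    by (simp add: nct_R_def)
  have right: "complex_of_real (nct_R n x \<delta>) =
      of_real (1/2 * erfc (\<delta> / sqrt 2)) - nct_vline c n \<delta> y"
    unfolding nct_vline_right[OF assms(1,3-6)] R of_real_diff ..
  have left: "complex_of_real (nct_R n x \<delta>) = - nct_vline d n \<delta> y"
    unfolding nct_vline_left[OF assms(1,3,9,7,8)] by simp
  have minus: "vline_integral d (\<lambda>t. - ?f t) = - vline_integral d ?f"
    by (simp add: vline_integral_def)
  show ?thesis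
    unfolding flip minus mult_minus_right
    by (intro conjI integrable right [unfolded nct_vline_def] left [unfolded nct_vline_def])
      (simp_all add: nct_F_def nct_R_def)
qed

end
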